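(* Let $n\ge 1$, let $\varphi=(\varphi_1,\dots,\varphi_n)$ and $\psi=(\psi_1,\dots,\psi_n)$ be holomorphic self-maps of $\mathcal{H}^n$, and let $\gamma=(\gamma_1,\dots,\gamma_n)$ with $\gamma_k>0$ for all $k$. Suppose that $C_\varphi-C_\psi$ is an operator from $\mathcal{A}^{-\gamma}(\mathcal{H}^n)$ to $\mathcal{A}^{-\gamma}(\mathcal{H}^n)$ (i.e. $(C_\varphi-C_\psi)f\in\mathcal{A}^{-\gamma}(\mathcal{H}^n)$ for every $f\in\mathcal{A}^{-\gamma}(\mathcal{H}^n)$). Then the following are equivalent: (1) $C_\varphi-C_\psi:\mathcal{A}^{-\gamma}(\mathcal{H}^n)\to\mathcal{A}^{-\gamma}(\mathcal{H}^n)$ is compact; (2) $\displaystyle \lim_{\varphi(z)\to\partial\widehat{\mathcal{H}^n}}\rho(z)\prod_{k=1}^n\left(\frac{\mathrm{Im}\,z_k}{\mathrm{Im}\,\varphi_k(z)}\right)^{\gamma_k}+\lim_{\psi(z)\to\partial\widehat{\mathcal{H}^n}}\rho(z)\prod_{k=1}^n\left(\frac{\mathrm{Im}\,z_k}{\mathrm{Im}\,\psi_k(z)}\right)^{\gamma_k}=0$, that is, both limits exist and equal $0$.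
   Context: $\mathcal{H}=\{z\in\mathbb{C}:\mathrm{Im}\,z>0\}$ and $\mathcal{H}^n=\{z=(z_1,\dots,z_n)\in\mathbb{C}^n:\mathrm{Im}\,z_k>0,\ k=1,\dots,n\}$. $H(\mathcal{H}^n)$ is the set of holomorphic functions on $\mathcal{H}^n$. For $\gamma\in\mathbb{R}^n$ with all $\gamma_k>0$, the Korenblum space is the Banach space $$\mathcal{A}^{-\gamma}(\mathcal{H}^n)=\Big\{f\in H(\mathcal{H}^n):\|f\|_{\mathcal{A}^{-\gamma}(\mathcal{H}^n)}=\sup_{z\in\mathcal{H}^n}|f(z)|\prod_{k=1}^n(\mathrm{Im}\,z_k)^{\gamma_k}<\infty\Big\}.$$ For a holomorphic self-map $\varphi$ of $\mathcal{H}^n$, the composition operator is $(C_\varphi f)(z)=f(\varphi(z))$ for $f\in H(\mathcal{H}^n)$. For $u,v\in\mathcal{H}$, $d(u,v)=\left|\frac{u-v}{u-\overline{v}}\right|$. For $z,w\in\mathcal{H}^n$, $\rho(z,w)=\max_{1\le k\le n}d(z_k,w_k)$. For the given $\varphi,\psi$, $\rho(z):=\rho(\varphi(z),\psi(z))$. For a nonnegative function $F$ on $\mathcal{H}^n$, $\lim_{\varphi(z)\to\partial\widehat{\mathcal{H}^n}}F(z)=0$ means: for every $\varepsilon>0$ there is a compact set $\Omega\subset\mathcal{H}^n$ such that $F(z)<\varepsilon$ for all $z\in\mathcal{H}^n$ with $\varphi(z)\in\mathcal{H}^n\setminus\Omega$ (the condition holds vacuously if $\varphi(\mathcal{H}^n)\subset\Omega$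 for some compact $\Omega\subset\mathcal{H}^n$); similarly with $\psi$ in place of $\varphi$. *)

theory Defs
  imports "HOL-Analysis.Analysis"
begin

definition upper_half :: "complex set" where
  "upper_half = {z. Im z > 0}"

definition poly_upper_half :: "(complex ^ 'n) set" where
  "poly_upper_half = {z. \<forall>k. z $ k \<in> upper_half}"

text \<open>Holomorphy in several variables: the Frechet derivative exists and is complex linear.
  It is used on open sets only.\<close>
definition holomorphic_several :: "(complex ^ 'n \<Rightarrow> complex) \<Rightarrow> (complex ^ 'n) set \<Rightarrow> bool" where
  "holomorphic_several f S \<longleftrightarrow>
     (\<forall>z\<in>S. \<exists>D. (f has_derivative D) (at z) \<and> (\<forall>c v. D (c *s v) = c * D v))"

definition holomorphic_self_map :: "(complex ^ 'n \<Rightarrow> complex ^ 'n) \<Rightarrow> bool" where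
  "holomorphic_self_map \<phi> \<longleftrightarrow>
     (\<forall>k. holomorphic_several (\<lambda>z. \<phi> z $ k) poly_upper_half) \<and>
     \<phi> ` poly_upper_half \<subseteq> poly_upper_half"

definition korenblum_quantity :: "real ^ 'n \<Rightarrow> (complex ^ 'n \<Rightarrow> complex) \<Rightarrow> complex ^ 'n \<Rightarrow> real" where
  "korenblum_quantity \<gamma> f z = cmod (f z) * (\<Prod>k\<in>UNIV. Im (z $ k) powr (\<gamma> $ k))"

definition korenblum_norm :: "real ^ 'n \<Rightarrow> (complex ^ 'n \<Rightarrow> complex) \<Rightarrow> real" where
  "korenblum_norm \<gamma> f = (SUP z\<in>poly_upper_half. korenblum_quantity \<gamma> f z)"

text \<open>A function on the domain is represented by its extension by zero, so that distinct
  elements of the space differ on the domain and the vector space operations are pointwise.\<close>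
definition korenblum_space :: "real ^ 'n \<Rightarrow> (complex ^ 'n \<Rightarrow> complex) set" where
  "korenblum_space \<gamma> =
     {f. holomorphic_several f poly_upper_half \<and>
         bdd_above (korenblum_quantity \<gamma> f ` poly_upper_half) \<and>
         (\<forall>z. z \<notin> poly_upper_half \<longrightarrow> f z = 0)}"

text \<open>The distance is the norm of the difference; its values off the space are irrelevant, but
  \<open>Metric_space\<close> wants them nonnegative.\<close>
definition korenblum_dist ::
    "real ^ 'n \<Rightarrow> (complex ^ 'n \<Rightarrow> complex) \<Rightarrow> (complex ^ 'n \<Rightarrow> complex) \<Rightarrow> real" where
  "korenblum_dist \<gamma> f g =
     (if f \<in> korenblum_space \<gamma> \<and> g \<in> korenblum_space \<gamma> then korenblum_norm \<gamma> (f - g) else 0)"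

definition korenblum_metric :: "real ^ 'n \<Rightarrow> (complex ^ 'n \<Rightarrow> complex) metric" where
  "korenblum_metric \<gamma> = metric (korenblum_space \<gamma>, korenblum_dist \<gamma>)"

definition comp_op ::
    "(complex ^ 'n \<Rightarrow> complex ^ 'n) \<Rightarrow> (complex ^ 'n \<Rightarrow> complex) \<Rightarrow> complex ^ 'n \<Rightarrow> complex" where
  "comp_op \<phi> f = (\<lambda>z. if z \<in> poly_upper_half then f (\<phi> z) else 0)"

text \<open>Compactness of an operator between normed spaces, given by their norm metrics: bounded sets
  are mapped to relatively compact sets. Linearity is not part of the definition.\<close>
definition compact_operator :: "'a metric \<Rightarrow> 'b metric \<Rightarrow> ('a \<Rightarrow> 'b) \<Rightarrow> bool" where
  "compact_operator X Y T \<longleftrightarrow>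
     T ` mspace X \<subseteq> mspace Y \<and>
     (\<forall>B. Metric_space.mbounded (mspace X) (mdist X) B \<longrightarrow>
          compactin (mtopology_of Y) (mtopology_of Y closure_of (T ` B)))"

definition pseudohyp :: "complex \<Rightarrow> complex \<Rightarrow> real" where
  "pseudohyp u v = cmod ((u - v) / (u - cnj v))"

definition poly_pseudohyp :: "complex ^ 'n \<Rightarrow> complex ^ 'n \<Rightarrow> real" where
  "poly_pseudohyp z w = Max (range (\<lambda>k. pseudohyp (z $ k) (w $ k)))"

text \<open>The function \<open>F\<close> has limit 0 as \<open>\<phi> z\<close> tends to the boundary of the domain,
  the point at infinity included.\<close>
definition boundary_limit_zero ::
    "(complex ^ 'n \<Rightarrow> complex ^ 'n) \<Rightarrow> (complex ^ 'n \<Rightarrow> real) \<Rightarrow> bool" where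
  "boundary_limit_zero \<phi> F \<longleftrightarrow>
     (\<forall>\<epsilon>>0. \<exists>\<Omega>. compact \<Omega> \<and> \<Omega> \<subseteq> poly_upper_half \<and>
        (\<forall>z\<in>poly_upper_half. \<phi> z \<in> poly_upper_half - \<Omega> \<longrightarrow> F z < \<epsilon>))"

lemma poly_upper_half_nonempty: "(poly_upper_half :: (complex ^ 'n) set) \<noteq> {}"
proof -
  have "(\<chi> k. \<i>) \<in> (poly_upper_half :: (complex ^ 'n) set)"
    by (simp add: poly_upper_half_def upper_half_def)
  then show ?thesis by blast
qed

lemma korenblum_quantity_nonneg: "korenblum_quantity \<gamma> f z \<ge> 0"
  by (simp add: korenblum_quantity_def prod_nonneg)

lemma korenblum_quantity_triangle:
  "korenblum_quantity \<gamma> (f - h) z \<le> korenblum_quantity \<gamma> (f - g) z + korenblum_quantity \<gamma> (g - h) z"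
proof -
  have "cmod (f z - h z) \<le> cmod (f z - g z) + cmod (g z - h z)"
    using norm_triangle_ineq[of "f z - g z" "g z - h z"] by simp
  then show ?thesis
    unfolding korenblum_quantity_def distrib_right[symmetric]
    by (intro mult_right_mono) (auto intro: prod_nonneg)
qed

lemma korenblum_space_diff:
  assumes f: "f \<in> korenblum_space \<gamma>" and g: "g \<in> korenblum_space \<gamma>"
  shows "f - g \<in> korenblum_space \<gamma>"
proof -
  have "holomorphic_several (f - g) poly_upper_half"
    unfolding holomorphic_several_def
  proof
    fix z :: "complex ^ 'a" assume "z \<in> poly_upper_half"
    then obtain D E where
        "(f has_derivative D) (at z)" "\<forall>c v. D (c *s v) = c * D v"
        "(g has_derivative E) (at z)" "\<forall>c v. E (c *s v) = c * E v"
      using f g unfolding korenblum_space_def holomorphic_several_def by blast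
    then show "\<exists>D. ((f - g) has_derivative D) (at z) \<and> (\<forall>c v. D (c *s v) = c * D v)"
      by (intro exI[of _ "\<lambda>v. D v - E v"])
        (auto simp: fun_diff_def right_diff_distrib intro: has_derivative_diff)
  qed
  moreover have "bdd_above (korenblum_quantity \<gamma> (f - g) ` poly_upper_half)"
  proof -
    obtain A B where A: "\<And>z. z \<in> poly_upper_half \<Longrightarrow> korenblum_quantity \<gamma> f z \<le> A"
      and B: "\<And>z. z \<in> poly_upper_half \<Longrightarrow> korenblum_quantity \<gamma> g z \<le> B"
      using f g unfolding korenblum_space_def bdd_above_def by fast
    have "korenblum_quantity \<gamma> (f - g) z \<le> A + B" if "z \<in> poly_upper_half" for z
      using korenblum_quantity_triangle[of \<gamma> f g z "\<lambda>_. 0"] A[OF that] B[OF that]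
      by (simp add: korenblum_quantity_def)
    then show ?thesis by (intro bdd_aboveI2[where M = "A + B"])
  qed
  ultimately show ?thesis
    using f g by (auto simp: korenblum_space_def)
qed

lemma Metric_space_korenblum: "Metric_space (korenblum_space \<gamma>) (korenblum_dist \<gamma>)"
proof -
  have upper: "korenblum_quantity \<gamma> f z \<le> korenblum_norm \<gamma> f"
    if "f \<in> korenblum_space \<gamma>" "z \<in> poly_upper_half" for f z
    using that unfolding korenblum_norm_def korenblum_space_def
    by (auto intro: cSUP_upper)
  have nonneg: "korenblum_norm \<gamma> f \<ge> 0" if "f \<in> korenblum_space \<gamma>" for f
    using poly_upper_half_nonempty upper[OF that] korenblum_quantity_nonneg[of \<gamma> f]
    by (meson all_not_in_conv order_trans)
  show ?thesis
  proof
    show "0 \<le> korenblum_dist \<gamma> f g" for f g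
      by (simp add: korenblum_dist_def nonneg korenblum_space_diff)
    show "korenblum_dist \<gamma> f g = korenblum_dist \<gamma> g f" for f g
      by (simp add: korenblum_dist_def korenblum_norm_def korenblum_quantity_def norm_minus_commute)
    show "korenblum_dist \<gamma> f g = 0 \<longleftrightarrow> f = g"
      if f: "f \<in> korenblum_space \<gamma>" and g: "g \<in> korenblum_space \<gamma>" for f g
    proof
      assume "korenblum_dist \<gamma> f g = 0"
      then have norm0: "korenblum_norm \<gamma> (f - g) = 0" using f g by (simp add: korenblum_dist_def)
      show "f = g"
      proof
        fix z
        show "f z = g z"
        proof (cases "z \<in> poly_upper_half")
          case True
          have "korenblum_quantity \<gamma> (f - g) z = 0"
            using upper[OF korenblum_space_diff[OF f g] True] norm0
              korenblum_quantity_nonneg[of \<gamma> "f - g" z] by simp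
          moreover have "Im (z $ k) \<noteq> 0" for k
            using True by (simp add: poly_upper_half_def upper_half_def less_imp_neq[THEN not_sym])
          ultimately show ?thesis by (simp add: korenblum_quantity_def)
        next
          case False
          then show ?thesis using f g by (simp add: korenblum_space_def)
        qed
      qed
    next
      assume "f = g"
      then show "korenblum_dist \<gamma> f g = 0"
        by (simp add: korenblum_dist_def korenblum_norm_def korenblum_quantity_def
            poly_upper_half_nonempty)
    qed
    show "korenblum_dist \<gamma> f h \<le> korenblum_dist \<gamma> f g + korenblum_dist \<gamma> g h"
      if f: "f \<in> korenblum_space \<gamma>" and g: "g \<in> korenblum_space \<gamma>" and h: "h \<in> korenblum_space \<gamma>"
      for f g h
    proof -
      have "korenblum_norm \<gamma> (f - h) \<le> korenblum_norm \<gamma> (f - g) + korenblum_norm \<gamma> (g - h)"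
        unfolding korenblum_norm_def[of \<gamma> "f - h"]
      proof (rule cSUP_least[OF poly_upper_half_nonempty])
        fix z :: "complex ^ 'a" assume z: "z \<in> poly_upper_half"
        show "korenblum_quantity \<gamma> (f - h) z \<le> korenblum_norm \<gamma> (f - g) + korenblum_norm \<gamma> (g - h)"
          using korenblum_quantity_triangle[of \<gamma> f h z g]
            upper[OF korenblum_space_diff[OF f g] z] upper[OF korenblum_space_diff[OF g h] z]
          by linarith
      qed
      then show ?thesis using f g h by (simp add: korenblum_dist_def)
    qed
  qed
qed

lemma mspace_korenblum_metric [simp]: "mspace (korenblum_metric \<gamma>) = korenblum_space \<gamma>"
  by (simp add: korenblum_metric_def Metric_space.mspace_metric[OF Metric_space_korenblum])

lemma mdist_korenblum_metric [simp]: "mdist (korenblum_metric \<gamma>) = korenblum_dist \<gamma>"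
  by (simp add: korenblum_metric_def Metric_space.mdist_metric[OF Metric_space_korenblum])

end

theory Submission
  imports Defs "HOL-Complex_Analysis.Great_Picard"
begin

text \<open>
  Write \<open>T = comp_op \<phi> - comp_op \<psi>\<close>, \<open>W z\<close> for the product of the \<open>Im (z $ k) powr \<gamma> $ k\<close>, and
  \<open>\<rho> z\<close> for the pseudohyperbolic distance of \<open>\<phi> z\<close> and \<open>\<psi> z\<close>.

  If \<open>T\<close> is compact, it maps bounded sequences that tend to zero pointwise to sequences that tend to
  zero in norm (\<open>compact_difference_preserves_null_sequences\<close>). Such sequences are the normalised kernels
  \<open>K\<close> at points \<open>w = \<phi> z\<close> leaving every compact set, and their products with the Blaschke factors \<open>b\<close> that
  vanish at \<open>w\<close>. Since \<open>b (\<phi> z) = 0\<close> and, for the best coordinate, \<open>cmod (b (\<psi> z)) = \<rho> z\<close>, the values of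
  \<open>T K\<close> and \<open>T (K * b)\<close> at \<open>z\<close> together dominate \<open>K w * \<rho> z\<close>, which up to a constant is \<open>\<rho> z / W (\<phi> z)\<close>
  (\<open>kernel_separates\<close>). After multiplication by \<open>W z\<close> this is the boundary condition.

  Conversely, the Schwarz lemma on complex lines shows that functions in the space satisfy a Lipschitz
  estimate in the pseudohyperbolic distance (\<open>pseudohyp_lipschitz\<close>). Where \<open>\<phi> z\<close> or \<open>\<psi> z\<close> is near the
  boundary, the boundary condition makes \<open>T f\<close> small in terms of the norm of \<open>f\<close>. Where they stay in a
  compact set, \<open>T f\<close> is small if \<open>f\<close> is small on a larger compact set, provided that \<open>\<rho> z * W z\<close> is
  bounded there. That bound holds because \<open>T\<close> acts on the space: finitely many test functions
  detect it (\<open>pseudohyp_weight_bounded_on_box\<close>). The result is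
  \<open>difference_controlled_on_boxes\<close>, from which compactness follows by Montel's theorem
  (\<open>korenblum_montel\<close>).
\<close>

section \<open>Slices of holomorphic functions of several variables\<close>

lemma norm_vector_scalar_mult_complex: "norm (c *s v) = cmod c * norm v" for v :: "complex ^ 'n"
  by (simp add: norm_vec_def norm_mult L2_set_right_distrib)

lemma slice_in_ball_iff: "u + c *s v \<in> ball u r \<longleftrightarrow> cmod c * norm v < r" for u v :: "complex ^ 'n"
proof -
  have "dist u (u + c *s v) = norm (c *s v)" by (metis add_diff_cancel_left' dist_commute dist_norm)
  then show ?thesis by (simp add: norm_vector_scalar_mult_complex)
qed

lemma bounded_linear_vector_scalar_mult_left:
  "bounded_linear (\<lambda>c. c *s v)" for v :: "complex ^ 'n"
  unfolding linear_conv_bounded_linear[symmetric]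
  by (rule linearI) (vector algebra_simps)+

lemma slice_has_field_derivative:
  fixes f :: "complex ^ 'n \<Rightarrow> complex"
  assumes f: "(f has_derivative D) (at (u + \<zeta> *s h))" and D: "\<And>c v. D (c *s v) = c * D v"
  shows "((\<lambda>\<zeta>. f (u + \<zeta> *s h)) has_field_derivative D h) (at \<zeta>)"
proof -
  have "((\<lambda>\<zeta>. u + \<zeta> *s h) has_derivative (\<lambda>c. c *s h)) (at \<zeta>)"
    by (auto intro!: derivative_eq_intros
        bounded_linear.has_derivative[OF bounded_linear_vector_scalar_mult_left])
  from has_derivative_compose[OF this f] show ?thesis
    by (simp add: has_field_derivative_def D mult_commute_abs)
qed

lemma holomorphic_on_slice:
  fixes f :: "complex ^ 'n \<Rightarrow> complex"
  assumes "holomorphic_several f S" and "\<And>\<zeta>. \<zeta> \<in> B \<Longrightarrow> u + \<zeta> *s h \<in> S"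
  shows "(\<lambda>\<zeta>. f (u + \<zeta> *s h)) holomorphic_on B"
  unfolding holomorphic_on_def
proof
  fix \<zeta> assume "\<zeta> \<in> B"
  then obtain D where "(f has_derivative D) (at (u + \<zeta> *s h))" "\<And>c v. D (c *s v) = c * D v"
    using assms unfolding holomorphic_several_def by blast
  from slice_has_field_derivative[OF this]
  show "(\<lambda>\<zeta>. f (u + \<zeta> *s h)) field_differentiable at \<zeta> within B"
    using field_differentiable_at_within field_differentiable_def by blast
qed

text \<open>The Schwarz lemma, applied to \<open>f (u + \<zeta> *s h) - f u\<close>, which vanishes at \<open>\<zeta> = 0\<close> and is bounded by
  \<open>2 * M\<close> on the disc of radius \<open>R\<close>. All estimates in several variables below come from this one:
  a direction \<open>h\<close> that leaves room for a large disc gives a small increment at \<open>\<zeta> = 1\<close>.\<close>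
lemma slice_schwarz:
  fixes f :: "complex ^ 'n \<Rightarrow> complex"
  assumes f: "holomorphic_several f S"
    and S: "\<And>\<zeta>. cmod \<zeta> < R \<Longrightarrow> u + \<zeta> *s h \<in> S"
    and M: "\<And>\<zeta>. cmod \<zeta> < R \<Longrightarrow> cmod (f (u + \<zeta> *s h)) \<le> M"
    and \<zeta>: "cmod \<zeta> < R"
  shows "cmod (f (u + \<zeta> *s h) - f u) \<le> 2 * M * cmod \<zeta> / R"
proof -
  have R: "R > 0" using \<zeta> by (meson norm_ge_zero order_le_less_trans)
  have M0: "M \<ge> 0" using M[OF \<zeta>] norm_ge_zero order_trans by blast
  \<comment> \<open>The Schwarz lemma wants values strictly inside the unit disc; hence the bound is enlarged and then let go.\<close>
  have *: "cmod (f (u + \<zeta> *s h) - f u) \<le> 2 * M' * cmod \<zeta> / R" if "M' > M" for M'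
  proof -
    define g where "g = (\<lambda>w. (f (u + (of_real R * w) *s h) - f u) / of_real (2 * M'))"
    have in_R: "cmod (of_real R * w) < R" if "cmod w < 1" for w
      using that R by (simp add: norm_mult)
    have "(\<lambda>w. f (u + (of_real R * w) *s h)) = (\<lambda>w. f (u + w *s (of_real R *s h)))"
      by (simp add: vector_smult_assoc mult.commute)
    then have "(\<lambda>w. f (u + (of_real R * w) *s h)) holomorphic_on ball 0 1"
      using holomorphic_on_slice[OF f, of "ball 0 1" u "of_real R *s h"] S in_R
      by (simp add: vector_smult_assoc mult.commute)
    then have hol: "g holomorphic_on ball 0 1"
      unfolding g_def using that M0 by (intro holomorphic_intros) auto
    have bound: "cmod (g w) < 1" if "cmod w < 1" for w
    proof -
      have "cmod (f (u + (of_real R * w) *s h) - f u) \<le> M + M"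
        using M[OF in_R[OF that]] M[of 0] R
        by (intro norm_triangle_le_diff add_mono) auto
      then show ?thesis using \<open>M' > M\<close> M0 by (simp add: g_def norm_divide field_simps)
    qed
    have "cmod (g (\<zeta> / of_real R)) \<le> cmod (\<zeta> / of_real R)"
      by (rule Schwarz_Lemma(1)[OF hol _ bound]) (use \<zeta> R in \<open>auto simp: g_def norm_divide\<close>)
    then show ?thesis
      using R that M0 by (simp add: g_def norm_divide field_simps)
  qed
  show ?thesis
  proof (rule field_le_epsilon)
    fix e :: real assume "e > 0"
    define M' where "M' = M + e / 2"
    have "cmod (f (u + \<zeta> *s h) - f u) \<le> 2 * M' * cmod \<zeta> / R"
      using *[of M'] \<open>e > 0\<close> unfolding M'_def by simp
    also have "\<dots> = 2 * M * cmod \<zeta> / R + e * (cmod \<zeta> / R)"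
      using R by (simp add: M'_def field_simps)
    also have "\<dots> \<le> 2 * M * cmod \<zeta> / R + e * 1"
      using \<zeta> R \<open>e > 0\<close> by (intro add_left_mono mult_left_mono) auto
    finally show "cmod (f (u + \<zeta> *s h) - f u) \<le> 2 * M * cmod \<zeta> / R + e" by simp
  qed
qed

lemma holomorphic_several_lipschitz_at_center:
  fixes f :: "complex ^ 'n \<Rightarrow> complex"
  assumes f: "holomorphic_several f S" and S: "ball u r \<subseteq> S"
    and M: "\<And>z. z \<in> ball u r \<Longrightarrow> cmod (f z) \<le> M" and y: "y \<in> ball u r"
  shows "cmod (f y - f u) \<le> 2 * M * norm (y - u) / r"
proof (cases "y = u")
  case False
  define n where "n = norm (y - u)"
  have n: "n > 0" "n < r" using False y by (auto simp: n_def dist_norm norm_minus_commute)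
  have in_ball: "u + \<zeta> *s (y - u) \<in> ball u r" if "cmod \<zeta> < r / n" for \<zeta>
    using that n unfolding slice_in_ball_iff by (simp add: n_def field_simps)
  have "cmod (f (u + 1 *s (y - u)) - f u) \<le> 2 * M * cmod 1 / (r / n)"
    by (rule slice_schwarz[OF f]) (use in_ball S M n in auto)
  then show ?thesis by (simp add: n_def)
qed simp

text \<open>A Cauchy estimate for the whole Frechet derivative. It is what makes the derivatives of a locally
  uniformly Cauchy sequence uniformly Cauchy.\<close>
lemma holomorphic_several_derivative_bound:
  fixes f :: "complex ^ 'n \<Rightarrow> complex"
  assumes f: "holomorphic_several f S" and S: "ball u r \<subseteq> S" and r: "r > 0"
    and M: "\<And>z. z \<in> ball u r \<Longrightarrow> cmod (f z) \<le> M"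
    and D: "(f has_derivative D) (at u)" and lin: "\<And>c v. D (c *s v) = c * D v"
  shows "cmod (D h) \<le> 2 * M / r * norm h"
proof -
  have "(\<lambda>\<zeta>. (f (u + \<zeta> *s h) - f u) / \<zeta>) \<midarrow>0\<rightarrow> D h"
    using slice_has_field_derivative[of f D u 0 h] D lin by (simp add: DERIV_def)
  moreover have "\<forall>\<^sub>F \<zeta> in at 0. cmod ((f (u + \<zeta> *s h) - f u) / \<zeta>) \<le> 2 * M / r * norm h"
    unfolding eventually_at
  proof (intro exI conjI ballI impI)
    show "0 < r / (norm h + 1)" using r by (simp add: add_nonneg_pos)
    fix \<zeta> :: complex assume \<zeta>: "\<zeta> \<noteq> 0 \<and> dist \<zeta> 0 < r / (norm h + 1)"
    have "cmod \<zeta> * norm h \<le> cmod \<zeta> * (norm h + 1)" by (intro mult_left_mono) auto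
    also have "\<dots> < r" using \<zeta> by (simp add: pos_less_divide_eq add_nonneg_pos)
    finally have "u + \<zeta> *s h \<in> ball u r"
      by (simp only: slice_in_ball_iff)
    from holomorphic_several_lipschitz_at_center[OF f S M this]
    have "cmod (f (u + \<zeta> *s h) - f u) \<le> 2 * M * (cmod \<zeta> * norm h) / r"
      by (simp add: norm_vector_scalar_mult_complex)
    then show "cmod ((f (u + \<zeta> *s h) - f u) / \<zeta>) \<le> 2 * M / r * norm h"
      using \<zeta> by (simp add: norm_divide field_simps)
  qed
  ultimately show ?thesis
    by (rule Lim_norm_ubound[OF at_neq_bot])
qed

section \<open>Locally uniform limits and normal families\<close>

lemma holomorphic_several_diff:
  assumes "holomorphic_several f S" "holomorphic_several g S"
  shows "holomorphic_several (\<lambda>z. f z - g z) S"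
  unfolding holomorphic_several_def
proof
  fix z assume "z \<in> S"
  then obtain D E where
      "(f has_derivative D) (at z)" "\<forall>c v. D (c *s v) = c * D v"
      "(g has_derivative E) (at z)" "\<forall>c v. E (c *s v) = c * E v"
    using assms unfolding holomorphic_several_def by blast
  then show "\<exists>D. ((\<lambda>z. f z - g z) has_derivative D) (at z) \<and> (\<forall>c v. D (c *s v) = c * D v)"
    by (intro exI[of _ "\<lambda>v. D v - E v"]) (auto simp: right_diff_distrib intro: has_derivative_diff)
qed

text \<open>Weierstrass' theorem. Near a point, the derivative bound turns uniform smallness of \<open>F n - F m\<close> into
  uniform smallness of the difference of the derivatives, so the derivatives converge uniformly in
  operator norm and differentiation commutes with the limit. Complex linearity is a closed condition.\<close>
lemma holomorphic_several_uniform_limit: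
  fixes F :: "nat \<Rightarrow> complex ^ 'n \<Rightarrow> complex"
  assumes S: "open S" and hol: "\<And>n. holomorphic_several (F n) S"
    and lim: "\<And>K. compact K \<Longrightarrow> K \<subseteq> S \<Longrightarrow> uniform_limit K F g sequentially"
  shows "holomorphic_several g S"
  unfolding holomorphic_several_def
proof
  fix u assume u: "u \<in> S"
  obtain R where R: "R > 0" "cball u R \<subseteq> S" using S u open_contains_cball by blast
  \<comment> \<open>The radius is halved so that balls of one fixed radius around all nearby points lie in one compact set.\<close>
  define r where "r = R / 2"
  have r: "r > 0" "cball u (2 * r) \<subseteq> S" using R by (auto simp: r_def)
  have sub: "ball x r \<subseteq> cball u (2 * r)" if "x \<in> ball u r" for x
    using that by (auto simp: dist_norm) (smt (verit) norm_triangle_ineq4 norm_minus_commute dist_norm dist_triangle)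
  obtain D where D: "\<And>n x. x \<in> S \<Longrightarrow> (F n has_derivative D n x) (at x)"
    and lin: "\<And>n x c v. x \<in> S \<Longrightarrow> D n x (c *s v) = c * D n x v"
  proof -
    have "\<forall>n. \<forall>x\<in>S. \<exists>D. (F n has_derivative D) (at x) \<and> (\<forall>c v. D (c *s v) = c * D v)"
      using hol unfolding holomorphic_several_def by blast
    then show ?thesis using that by metis
  qed
  have uS: "x \<in> S" if "x \<in> ball u r" for x using sub[OF that] that r by auto
  have cauchy: "\<exists>N. \<forall>n\<ge>N. \<forall>m\<ge>N. \<forall>x\<in>ball u r. \<forall>h. cmod (D n x h - D m x h) \<le> e * norm h"
    if e: "e > 0" for e
  proof -
    define d where "d = e * r / 4"
    have d: "d > 0" using e r by (simp add: d_def)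
    obtain N where N: "\<And>n x. n \<ge> N \<Longrightarrow> x \<in> cball u (2 * r) \<Longrightarrow> dist (F n x) (g x) < d"
      using lim[OF compact_cball r(2)] d unfolding uniform_limit_sequentially_iff by meson
    have "cmod (D n x h - D m x h) \<le> e * norm h" if nm: "n \<ge> N" "m \<ge> N" and x: "x \<in> ball u r" for n m x h
    proof -
      have bound: "cmod (F n z - F m z) \<le> 2 * d" if "z \<in> ball x r" for z
      proof -
        have "z \<in> cball u (2 * r)" using sub[OF x] that by blast
        from N[OF nm(1) this] N[OF nm(2) this] show ?thesis
          by (smt (verit) dist_norm norm_minus_commute dist_triangle2)
      qed
      have "cmod ((\<lambda>h. D n x h - D m x h) h) \<le> 2 * (2 * d) / r * norm h"
      proof (rule holomorphic_several_derivative_bound[OF holomorphic_several_diff[OF hol hol] _ r(1) bound])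
        show "ball x r \<subseteq> S" using sub[OF x] r by blast
        show "((\<lambda>z. F n z - F m z) has_derivative (\<lambda>h. D n x h - D m x h)) (at x)"
          by (intro has_derivative_diff D uS[OF x])
      qed (auto simp: lin[OF uS[OF x]] right_diff_distrib)
      then show ?thesis using r by (simp add: d_def)
    qed
    then show ?thesis by blast
  qed
  have conv: "convergent (\<lambda>n. D n x h)" if x: "x \<in> ball u r" for x h
  proof (rule Cauchy_convergent, rule CauchyI)
    fix e :: real assume e: "e > 0"
    define d where "d = e / (norm h + 1)"
    have d: "d > 0" "d * norm h < e"
      using e by (auto simp: d_def field_simps add_nonneg_pos add_pos_nonneg)
    from cauchy[OF d(1)] show "\<exists>M. \<forall>m\<ge>M. \<forall>n\<ge>M. norm (D m x h - D n x h) < e"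
      using x d(2) by (meson order_le_less_trans)
  qed
  define D' where "D' = (\<lambda>x h. lim (\<lambda>n. D n x h))"
  have D': "(\<lambda>n. D n x h) \<longlonglongrightarrow> D' x h" if "x \<in> ball u r" for x h
    using conv[OF that] unfolding D'_def convergent_LIMSEQ_iff .
  have "\<exists>k. \<forall>x\<in>ball u r. (\<lambda>n. F n x) \<longlonglongrightarrow> k x \<and> (k has_derivative D' x) (at x within ball u r)"
  proof (rule has_derivative_sequence)
    show "convex (ball u r)" by simp
    show "(F n has_derivative D n x) (at x within ball u r)" if "x \<in> ball u r" for n x
      using D[OF uS[OF that]] has_derivative_at_withinI by blast
    show "u \<in> ball u r" using r by simp
    have "uniform_limit {u} F g sequentially" using lim[of "{u}"] u by simp
    then show "(\<lambda>n. F n u) \<longlonglongrightarrow> g u" by (rule tendsto_uniform_limitI) simp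
    fix e :: real assume "e > 0"
    then obtain N where N: "\<forall>n\<ge>N. \<forall>m\<ge>N. \<forall>x\<in>ball u r. \<forall>h. cmod (D n x h - D m x h) \<le> e * norm h"
      using cauchy by blast
    have "cmod (D n x h - D' x h) \<le> e * norm h" if "n \<ge> N" "x \<in> ball u r" for n x h
    proof (rule Lim_norm_ubound)
      show "(\<lambda>m. D n x h - D m x h) \<longlonglongrightarrow> D n x h - D' x h"
        by (intro tendsto_intros D' that)
      show "\<forall>\<^sub>F m in sequentially. cmod (D n x h - D m x h) \<le> e * norm h"
        using N that unfolding eventually_sequentially by blast
    qed simp
    then show "\<forall>\<^sub>F n in sequentially. \<forall>x\<in>ball u r. \<forall>h. cmod (D n x h - D' x h) \<le> e * norm h"
      unfolding eventually_sequentially by blast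
  qed
  then obtain k where k: "\<And>x. x \<in> ball u r \<Longrightarrow> (\<lambda>n. F n x) \<longlonglongrightarrow> k x"
    and dk: "\<And>x. x \<in> ball u r \<Longrightarrow> (k has_derivative D' x) (at x within ball u r)" by blast
  have "k x = g x" if "x \<in> ball u r" for x
  proof -
    have "uniform_limit {x} F g sequentially" using lim[of "{x}"] uS[OF that] by simp
    then have "(\<lambda>n. F n x) \<longlonglongrightarrow> g x" by (rule tendsto_uniform_limitI) simp
    with k[OF that] show ?thesis using LIMSEQ_unique by blast
  qed
  moreover have "(k has_derivative D' u) (at u)"
    using dk[of u] r by (simp add: at_within_open[of _ "ball u r"])
  ultimately have "(g has_derivative D' u) (at u)"
    using has_derivative_transform_within_open[of k "D' u" u UNIV "ball u r" g] r by auto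
  moreover have "D' u (c *s v) = c * D' u v" for c v
  proof (rule LIMSEQ_unique)
    show "(\<lambda>n. D n u (c *s v)) \<longlonglongrightarrow> D' u (c *s v)" using D' r by simp
    show "(\<lambda>n. D n u (c *s v)) \<longlonglongrightarrow> c * D' u v"
      unfolding lin[OF u] using D'[of u v] r by (intro tendsto_intros) simp
  qed
  ultimately show "\<exists>D. (g has_derivative D) (at u) \<and> (\<forall>c v. D (c *s v) = c * D v)" by blast
qed

text \<open>Local boundedness gives local equicontinuity by the Schwarz estimate; Arzela--Ascoli on each set of a
  compact exhaustion and a diagonal argument then give the subsequence.\<close>
lemma montel_several:
  fixes F :: "nat \<Rightarrow> complex ^ 'n \<Rightarrow> complex"
  assumes S: "open S" and hol: "\<And>n. holomorphic_several (F n) S"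
    and bounded: "\<And>K. compact K \<Longrightarrow> K \<subseteq> S \<Longrightarrow> \<exists>B. \<forall>n. \<forall>z\<in>K. cmod (F n z) \<le> B"
  shows "\<exists>g r. strict_mono (r :: nat \<Rightarrow> nat) \<and> holomorphic_several g S \<and>
    (\<forall>K. compact K \<and> K \<subseteq> S \<longrightarrow> uniform_limit K (\<lambda>n. F (r n)) g sequentially)"
proof -
  obtain C where C: "\<And>i::nat. compact (C i)" "\<And>i. C i \<subseteq> S"
    and exhaust: "\<And>K. compact K \<Longrightarrow> K \<subseteq> S \<Longrightarrow> \<exists>N. \<forall>i\<ge>N. K \<subseteq> C i"
    using open_Union_compact_subsets[OF S] by metis
  define P where "P = (\<lambda>i s. \<exists>g. uniform_limit (C i) (\<lambda>n. F (s n)) g sequentially)"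
  obtain k :: "nat \<Rightarrow> nat" where k: "strict_mono k" "\<And>i. P i (id \<circ> k)"
  proof (rule subsequence_diagonalization_lemma[of P id])
    fix i and s :: "nat \<Rightarrow> nat"
    obtain B where B: "\<And>n z. z \<in> C i \<Longrightarrow> cmod (F n z) \<le> B"
      using bounded[OF C] by metis
    obtain g k where "strict_mono (k :: nat \<Rightarrow> nat)"
      and g: "\<And>e. 0 < e \<Longrightarrow> \<exists>N. \<forall>n x. n \<ge> N \<and> x \<in> C i \<longrightarrow> norm (F (s (k n)) x - g x) < e"
    proof (rule Arzela_Ascoli[of "C i" "\<lambda>n. F (s n)" B])
      fix x and e :: real assume x: "x \<in> C i" and e: "e > 0"
      obtain r where r: "r > 0" "cball x r \<subseteq> S" using S C x open_contains_cball by blast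
      obtain B where B: "\<And>n z. z \<in> cball x r \<Longrightarrow> cmod (F n z) \<le> B"
        using bounded[OF compact_cball r(2)] by metis
      have "0 \<le> B" using B[of x 0] r by (meson centre_in_cball less_imp_le norm_ge_zero order_trans)
      define d where "d = min r (e * r / (2 * (B + 1)))"
      have d: "d > 0" using r e \<open>0 \<le> B\<close> by (simp add: d_def)
      have "cmod (F (s n) x - F (s n) y) < e" if "norm (x - y) < d" for n y
      proof -
        have y: "norm (y - x) < r" "norm (y - x) < e * r / (2 * (B + 1))"
          using that by (auto simp: d_def norm_minus_commute)
        have "cmod (F (s n) y - F (s n) x) \<le> 2 * B * norm (y - x) / r"
          by (rule holomorphic_several_lipschitz_at_center[OF hol, where u = x and r = r])
            (use r B y in \<open>auto simp: dist_norm norm_minus_commute\<close>)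
        also have "\<dots> \<le> 2 * (B + 1) * norm (y - x) / r"
          using r by (intro divide_right_mono mult_right_mono) auto
        also have "\<dots> < e" using y(2) r \<open>0 \<le> B\<close> by (simp add: field_simps)
        finally show ?thesis by (simp add: norm_minus_commute)
      qed
      with d show "\<exists>d>0. \<forall>n y. y \<in> C i \<and> norm (x - y) < d \<longrightarrow> norm (F (s n) x - F (s n) y) < e"
        by blast
    qed (use C B in auto)
    then show "\<exists>k. strict_mono k \<and> P i (s \<circ> k)"
      unfolding P_def uniform_limit_sequentially_iff o_def dist_norm by metis
  next
    fix i and s :: "nat \<Rightarrow> nat" and k1 k2 :: "nat \<Rightarrow> nat" and N
    assume "P i (s \<circ> k1)" and k2: "\<And>j. N \<le> j \<Longrightarrow> \<exists>j'\<ge>j. k2 j = k1 j'"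
    then obtain g where g: "uniform_limit (C i) (\<lambda>n. F (s (k1 n))) g sequentially"
      by (auto simp: P_def)
    have "uniform_limit (C i) (\<lambda>n. F (s (k2 n))) g sequentially"
      unfolding uniform_limit_sequentially_iff
    proof (intro allI impI)
      fix e :: real assume "e > 0"
      then obtain M where M: "\<forall>n\<ge>M. \<forall>x\<in>C i. dist (F (s (k1 n)) x) (g x) < e"
        using g unfolding uniform_limit_sequentially_iff by blast
      have "\<forall>x\<in>C i. dist (F (s (k2 n)) x) (g x) < e" if "n \<ge> max M N" for n
        using M k2[of n] that by (metis max.bounded_iff order_trans)
      then show "\<exists>N. \<forall>n\<ge>N. \<forall>x\<in>C i. dist (F (s (k2 n)) x) (g x) < e" by blast
    qed
    then show "P i (s \<circ> k2)" by (auto simp: P_def)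
  qed blast
  define g where "g = (\<lambda>x. lim (\<lambda>n. F (k n) x))"
  have g: "uniform_limit (C i) (\<lambda>n. F (k n)) g sequentially" for i
  proof -
    obtain h where h: "uniform_limit (C i) (\<lambda>n. F (k n)) h sequentially"
      using k(2)[of i] by (auto simp: P_def)
    have "g x = h x" if "x \<in> C i" for x
      unfolding g_def using tendsto_uniform_limitI[OF h that] by (rule limI)
    then show ?thesis using h uniform_limit_cong'[of "C i" "\<lambda>n. F (k n)" "\<lambda>n. F (k n)" g h] by auto
  qed
  have lim: "uniform_limit K (\<lambda>n. F (k n)) g sequentially" if "compact K" "K \<subseteq> S" for K
    using exhaust[OF that] g uniform_limit_on_subset by blast
  have "holomorphic_several g S"
    by (rule holomorphic_several_uniform_limit[OF S hol lim])
  with k(1) lim show ?thesis by blast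
qed

section \<open>Compact exhaustion of the product of half-planes\<close>

lemma Im_pos: "z \<in> poly_upper_half \<Longrightarrow> Im (z $ k) > 0"
  by (simp add: poly_upper_half_def upper_half_def)

lemma poly_upper_halfI: "(\<And>k. Im (z $ k) > 0) \<Longrightarrow> z \<in> poly_upper_half"
  by (simp add: poly_upper_half_def upper_half_def)

lemma open_poly_upper_half: "open (poly_upper_half :: (complex ^ 'n) set)"
proof -
  have "poly_upper_half = (\<Inter>k. {z :: complex ^ 'n. 0 < Im (z $ k)})"
    by (auto simp: poly_upper_half_def upper_half_def)
  moreover have "open (\<Inter>k. {z :: complex ^ 'n. 0 < Im (z $ k)})"
    by (intro open_INT ballI open_Collect_less continuous_intros) auto
  ultimately show ?thesis by simp
qed

text \<open>These boxes are cofinal among the compact subsets of the domain, so that leaving every compact set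
  means leaving every box: some coordinate is close to the real axis or large.\<close>
definition half_plane_box :: "real \<Rightarrow> real \<Rightarrow> (complex ^ 'n) set" where
  "half_plane_box a b = {z. \<forall>k. a \<le> Im (z $ k) \<and> cmod (z $ k) \<le> b}"

lemma half_plane_box_subset: 
  assumes a: "a > 0" shows "half_plane_box a b \<subseteq> (poly_upper_half :: (complex ^ 'n) set)"
proof
  fix z :: "complex ^ 'n" assume z: "z \<in> half_plane_box a b"
  have "a \<le> Im (z $ k)" for k using z by (simp add: half_plane_box_def)
  then show "z \<in> poly_upper_half" using a by (metis order_less_le_trans poly_upper_halfI)
qed

lemma compact_half_plane_box: "compact (half_plane_box a b :: (complex ^ 'n) set)"
  unfolding compact_eq_bounded_closed
proof
  have "norm z \<le> real CARD('n) * b" if "z \<in> half_plane_box a b" for z :: "complex ^ 'n"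
  proof -
    have "norm z \<le> (\<Sum>k\<in>UNIV. cmod (z $ k))"
      unfolding norm_vec_def by (rule L2_set_le_sum) simp
    also have "\<dots> \<le> (\<Sum>k\<in>(UNIV :: 'n set). b)"
      using that by (intro sum_mono) (simp add: half_plane_box_def)
    finally show ?thesis by simp
  qed
  then show "bounded (half_plane_box a b :: (complex ^ 'n) set)"
    unfolding bounded_iff by blast
  have "half_plane_box a b =
      (\<Inter>k. {z :: complex ^ 'n. a \<le> Im (z $ k)} \<inter> {z. cmod (z $ k) \<le> b})"
    by (auto simp: half_plane_box_def)
  moreover have "closed (\<Inter>k. {z :: complex ^ 'n. a \<le> Im (z $ k)} \<inter> {z. cmod (z $ k) \<le> b})"
    by (intro closed_INT ballI closed_Int closed_Collect_le continuous_intros)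
  ultimately show "closed (half_plane_box a b :: (complex ^ 'n) set)" by simp
qed

lemma compact_subset_half_plane_box:
  fixes K :: "(complex ^ 'n) set"
  assumes K: "compact K" "K \<subseteq> poly_upper_half"
  obtains a b where "a > 0" "K \<subseteq> half_plane_box a b"
proof -
  have "\<exists>a>0. \<forall>z\<in>K. a \<le> Im (z $ k)" for k
  proof (cases "K = {}")
    case False
    have "continuous_on K (\<lambda>z. Im (z $ k))" by (intro continuous_intros)
    then obtain z where "z \<in> K" "\<forall>y\<in>K. Im (z $ k) \<le> Im (y $ k)"
      using continuous_attains_inf[OF K(1) False] by blast
    then show ?thesis using Im_pos K(2) by blast
  qed (auto intro: exI[of _ 1])
  then obtain a where a: "\<And>k. a k > 0" "\<And>k z. z \<in> K \<Longrightarrow> a k \<le> Im (z $ k)" by metis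
  obtain b where b: "\<And>z. z \<in> K \<Longrightarrow> norm z \<le> b"
    using compact_imp_bounded[OF K(1)] unfolding bounded_iff by blast
  show thesis
  proof (rule that)
    show "Min (range a) > 0" using a by simp
    show "K \<subseteq> half_plane_box (Min (range a)) b"
    proof
      fix z assume z: "z \<in> K"
      have "Min (range a) \<le> Im (z $ k)" for k
        by (rule order_trans[OF Min_le a(2)[OF z]]) auto
      moreover have "cmod (z $ k) \<le> b" for k
        using Finite_Cartesian_Product.norm_nth_le[of z k] b[OF z] by simp
      ultimately show "z \<in> half_plane_box (Min (range a)) b"
        by (simp add: half_plane_box_def)
    qed
  qed
qed

section \<open>Pseudohyperbolic distance\<close>

lemma cmod_diff_cnj_ge:
  "Im u + Im v \<le> cmod (u - cnj v)"
  using abs_Im_le_cmod[of "u - cnj v"] by simp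

lemma pseudohyp_commute: "pseudohyp u v = pseudohyp v u"
proof -
  have "cmod (u - cnj v) = cmod (cnj (u - cnj v))" by (simp only: complex_mod_cnj)
  also have "\<dots> = cmod (v - cnj u)" by (simp add: norm_minus_commute)
  finally show ?thesis by (simp add: pseudohyp_def norm_divide norm_minus_commute)
qed

lemma cmod_diff_le_cmod_diff_cnj:
  assumes "Im u > 0" "Im v > 0" shows "cmod (u - v) \<le> cmod (u - cnj v)"
proof -
  have "(Im u - Im v)\<^sup>2 \<le> (Im u + Im v)\<^sup>2"
    using assms by (intro power2_le_iff_abs_le[THEN iffD2]) auto
  then show ?thesis by (simp add: cmod_def)
qed

lemma pseudohyp_le_1: "Im u > 0 \<Longrightarrow> Im v > 0 \<Longrightarrow> pseudohyp u v \<le> 1"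
  using cmod_diff_le_cmod_diff_cnj[of u v] by (simp add: pseudohyp_def norm_divide divide_le_eq_1)

text \<open>The point of this bound is its right-hand side: pseudohyperbolically close points differ by a small
  multiple of the distance to the real axis. It follows from
  \<open>cmod (u - cnj v) \<le> 2 * Im u + cmod (u - v)\<close> by absorbing the last summand.\<close>
lemma cmod_diff_le_pseudohyp:
  assumes "Im u > 0" "Im v > 0" "pseudohyp u v \<le> r" "r \<le> 1 / 8"
  shows "cmod (v - u) \<le> 4 * r * Im u"
proof -
  define t where "t = cmod (u - v)"
  have pos: "cmod (u - cnj v) > 0" using cmod_diff_cnj_ge[of u v] assms by linarith
  have r0: "0 \<le> r" using assms(3) norm_ge_zero order_trans unfolding pseudohyp_def by blast
  have "u - cnj v = (u - cnj u) + cnj (u - v)" by simp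
  then have "cmod (u - cnj v) \<le> cmod (u - cnj u) + cmod (cnj (u - v))"
    using norm_triangle_ineq by metis
  also have "\<dots> = 2 * Im u + t"
    using assms(1) by (simp add: t_def complex_diff_cnj norm_mult del: complex_cnj_diff)
  finally have le: "cmod (u - cnj v) \<le> 2 * Im u + t" .
  have "t \<le> r * cmod (u - cnj v)"
    using assms(3) pos by (simp add: pseudohyp_def norm_divide t_def field_simps)
  also have "\<dots> \<le> r * (2 * Im u + t)" using le r0 by (rule mult_left_mono)
  also have "\<dots> \<le> 2 * r * Im u + t / 8"
    using mult_right_mono[OF assms(4), of t] by (simp add: t_def algebra_simps)
  finally have "7 * t \<le> 16 * (r * Im u)" by simp
  moreover have "r * Im u \<ge> 0" using r0 assms by simp
  ultimately have "t \<le> 4 * (r * Im u)" by linarith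
  then show ?thesis by (simp add: t_def norm_minus_commute mult.assoc)
qed

lemma poly_pseudohyp_ge: "pseudohyp (u $ k) (v $ k) \<le> poly_pseudohyp u v"
  by (simp add: poly_pseudohyp_def)

lemma poly_pseudohyp_attained: "\<exists>k. poly_pseudohyp u v = pseudohyp (u $ k) (v $ k)"
proof -
  have "poly_pseudohyp u v \<in> range (\<lambda>k. pseudohyp (u $ k) (v $ k))"
    unfolding poly_pseudohyp_def by (rule Max_in) auto
  then show ?thesis by auto
qed

lemma poly_pseudohyp_nonneg: "0 \<le> poly_pseudohyp u v"
  using poly_pseudohyp_attained[of u v] by (auto simp: pseudohyp_def)

lemma poly_pseudohyp_commute: "poly_pseudohyp u v = poly_pseudohyp v u"
  by (simp add: poly_pseudohyp_def pseudohyp_commute)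

text \<open>A polydisc of fixed hyperbolic size, on which the weight is comparable to its value at the centre.\<close>
definition half_polydisc :: "complex ^ 'n \<Rightarrow> (complex ^ 'n) set" where
  "half_polydisc u = {z. \<forall>k. cmod (z $ k - u $ k) \<le> Im (u $ k) / 2}"

lemma half_polydisc_Im:
  assumes "z \<in> half_polydisc u" shows "Im (u $ k) / 2 \<le> Im (z $ k)"
proof -
  have "\<bar>Im (z $ k - u $ k)\<bar> \<le> Im (u $ k) / 2"
    using abs_Im_le_cmod[of "z $ k - u $ k"] assms unfolding half_polydisc_def
    by (blast intro: order_trans)
  then show ?thesis unfolding minus_complex.sel by linarith
qed

lemma half_polydisc_subset: "u \<in> poly_upper_half \<Longrightarrow> half_polydisc u \<subseteq> poly_upper_half"
proof
  fix z assume u: "u \<in> poly_upper_half" and z: "z \<in> half_polydisc u"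
  have "Im (z $ k) > 0" for k using half_polydisc_Im[OF z, of k] Im_pos[OF u, of k] by simp
  then show "z \<in> poly_upper_half" by (rule poly_upper_halfI)
qed

text \<open>The hypothesis keeps each \<open>v $ k\<close> within \<open>4 * \<rho> * Im (u $ k)\<close> of \<open>u $ k\<close>, where \<open>\<rho>\<close> is the distance of
  \<open>u\<close> and \<open>v\<close>. Hence the complex line through \<open>u\<close> and \<open>v\<close>, with \<open>u\<close> at \<open>0\<close> and \<open>v\<close> at \<open>1\<close>, stays in the
  polydisc for a whole disc of radius \<open>1 / (8 * \<rho>)\<close>, and the slice estimate applies.\<close>
lemma pseudohyp_lipschitz:
  assumes f: "holomorphic_several f poly_upper_half"
    and u: "u \<in> poly_upper_half" and v: "v \<in> poly_upper_half"
    and \<rho>: "poly_pseudohyp u v < 1 / 8"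
    and M: "\<And>z. z \<in> half_polydisc u \<Longrightarrow> cmod (f z) \<le> M"
  shows "cmod (f u - f v) \<le> 16 * M * poly_pseudohyp u v"
proof -
  define \<rho> where "\<rho> = poly_pseudohyp u v"
  have close: "cmod (v $ k - u $ k) \<le> 4 * \<rho> * Im (u $ k)" for k
    by (rule cmod_diff_le_pseudohyp)
      (use assms poly_pseudohyp_ge in \<open>auto simp: Im_pos \<rho>_def\<close>)
  show ?thesis
  proof (cases "\<rho> = 0")
    case True
    then have "v = u" using close by (simp add: vec_eq_iff)
    then show ?thesis using True by (simp add: \<rho>_def)
  next
    case False
    then have \<rho>: "\<rho> > 0" "\<rho> < 1 / 8"
      using poly_pseudohyp_nonneg[of u v] assms(4) by (auto simp: \<rho>_def)
    have in_polydisc: "u + \<zeta> *s (v - u) \<in> half_polydisc u" if "cmod \<zeta> < 1 / (8 * \<rho>)" for \<zeta>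
      unfolding half_polydisc_def
    proof (rule CollectI, rule allI)
      fix k
      have "cmod \<zeta> * cmod (v $ k - u $ k) \<le> 1 / (8 * \<rho>) * (4 * \<rho> * Im (u $ k))"
        using that close[of k] \<rho> by (intro mult_mono) auto
      then show "cmod ((u + \<zeta> *s (v - u)) $ k - u $ k) \<le> Im (u $ k) / 2"
        using \<rho> by (simp add: norm_mult right_diff_distrib[symmetric])
    qed
    have "cmod (f (u + 1 *s (v - u)) - f u) \<le> 2 * M * cmod 1 / (1 / (8 * \<rho>))"
      by (rule slice_schwarz[OF f])
        (use in_polydisc half_polydisc_subset[OF u] M \<rho> in auto)
    then show ?thesis using \<rho> by (simp add: \<rho>_def norm_minus_commute)
  qed
qed

section \<open>The Korenblum weight\<close>

definition korenblum_weight :: "real ^ 'n \<Rightarrow> complex ^ 'n \<Rightarrow> real" where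
  "korenblum_weight \<gamma> z = (\<Prod>k\<in>UNIV. Im (z $ k) powr (\<gamma> $ k))"

lemma korenblum_quantity_eq: "korenblum_quantity \<gamma> f z = cmod (f z) * korenblum_weight \<gamma> z"
  by (simp add: korenblum_quantity_def korenblum_weight_def)

lemma korenblum_weight_pos: 
  assumes "z \<in> poly_upper_half" shows "korenblum_weight \<gamma> z > 0"
proof -
  have "Im (z $ k) \<noteq> 0" for k using Im_pos[OF assms, of k] by simp
  then show ?thesis unfolding korenblum_weight_def by (intro prod_pos) simp
qed

lemma korenblum_weight_le:
  assumes "\<And>k. \<gamma> $ k \<ge> 0" "\<And>k. Im (u $ k) \<ge> 0" "\<And>k. Im (u $ k) \<le> c * Im (v $ k)" "c \<ge> 0"
    "v \<in> poly_upper_half"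
  shows "korenblum_weight \<gamma> u \<le> (\<Prod>k\<in>UNIV. c powr (\<gamma> $ k)) * korenblum_weight \<gamma> v"
  unfolding korenblum_weight_def prod.distrib[symmetric]
proof (rule prod_mono, intro conjI)
  fix k
  have "Im (u $ k) powr \<gamma> $ k \<le> (c * Im (v $ k)) powr \<gamma> $ k"
    using assms by (intro powr_mono2) auto
  then show "Im (u $ k) powr \<gamma> $ k \<le> c powr \<gamma> $ k * Im (v $ k) powr \<gamma> $ k"
    using assms Im_pos[of v k] by (simp add: powr_mult)
qed simp

lemma korenblum_weight_ratio:
  assumes "z \<in> poly_upper_half" "w \<in> poly_upper_half"
  shows "(\<Prod>k\<in>UNIV. (Im (z $ k) / Im (w $ k)) powr (\<gamma> $ k))
    = korenblum_weight \<gamma> z / korenblum_weight \<gamma> w"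
proof -
  have "(Im (z $ k) / Im (w $ k)) powr (\<gamma> $ k) = Im (z $ k) powr (\<gamma> $ k) / Im (w $ k) powr (\<gamma> $ k)" for k
    by (rule powr_divide)
  then show ?thesis by (simp add: korenblum_weight_def prod_dividef)
qed

section \<open>Test functions\<close>

lemma holomorphic_several_const: "holomorphic_several (\<lambda>z. c) S"
  unfolding holomorphic_several_def by (intro ballI exI[of _ "\<lambda>v. 0"]) auto

lemma holomorphic_several_mult:
  assumes "holomorphic_several f S" "holomorphic_several g S"
  shows "holomorphic_several (\<lambda>z. f z * g z) S"
  unfolding holomorphic_several_def
proof
  fix z assume "z \<in> S"
  then obtain D E where
      "(f has_derivative D) (at z)" "\<forall>c v. D (c *s v) = c * D v"
      "(g has_derivative E) (at z)" "\<forall>c v. E (c *s v) = c * E v"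
    using assms unfolding holomorphic_several_def by blast
  then show "\<exists>D. ((\<lambda>z. f z * g z) has_derivative D) (at z) \<and> (\<forall>c v. D (c *s v) = c * D v)"
    by (intro exI[of _ "\<lambda>v. f z * E v + D v * g z"])
      (auto simp: algebra_simps intro!: derivative_eq_intros)
qed

lemma holomorphic_several_prod:
  assumes "finite I" "\<And>i. i \<in> I \<Longrightarrow> holomorphic_several (f i) S"
  shows "holomorphic_several (\<lambda>z. \<Prod>i\<in>I. f i z) S"
  using assms by (induction I rule: finite_induct)
    (auto intro!: holomorphic_several_const holomorphic_several_mult)

lemma holomorphic_several_coordinate:
  assumes g: "g holomorphic_on upper_half"
  shows "holomorphic_several (\<lambda>z :: complex ^ 'n. g (z $ k)) poly_upper_half"
  unfolding holomorphic_several_def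
proof
  fix z :: "complex ^ 'n" assume z: "z \<in> poly_upper_half"
  have "open upper_half" unfolding upper_half_def by (simp add: open_halfspace_Im_gt)
  moreover have "z $ k \<in> upper_half" using z by (simp add: poly_upper_half_def)
  ultimately obtain g' where "(g has_field_derivative g') (at (z $ k))"
    using g holomorphic_on_imp_differentiable_at field_differentiable_def by blast
  moreover have "((\<lambda>z. z $ k) has_derivative (\<lambda>v. v $ k)) (at z)"
    by (rule bounded_linear.has_derivative[OF bounded_linear_vec_nth has_derivative_ident])
  ultimately have "((\<lambda>z. g (z $ k)) has_derivative (\<lambda>v. g' * v $ k)) (at z)"
    using has_derivative_compose unfolding has_field_derivative_def by blast
  then show "\<exists>D. ((\<lambda>z. g (z $ k)) has_derivative D) (at z) \<and> (\<forall>c v. D (c *s v) = c * D v)"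
    by (intro exI[of _ "\<lambda>v. g' * v $ k"]) simp
qed

lemma holomorphic_several_transform:
  assumes "open S" "holomorphic_several f S" "\<And>z. z \<in> S \<Longrightarrow> f z = g z"
  shows "holomorphic_several g S"
  unfolding holomorphic_several_def
proof
  fix z assume z: "z \<in> S"
  then obtain D where "(f has_derivative D) (at z)" "\<forall>c v. D (c *s v) = c * D v"
    using assms(2) unfolding holomorphic_several_def by blast
  then show "\<exists>D. (g has_derivative D) (at z) \<and> (\<forall>c v. D (c *s v) = c * D v)"
    using has_derivative_transform_within_open[of f D z UNIV S g] assms(1,3) z by auto
qed

text \<open>A power of the Bergman-type kernel of the half-plane in each variable, normalised so that the
  Korenblum norm stays at most one for every \<open>w\<close>, while the weighted modulus at \<open>w\<close> itself does not
  depend on \<open>w\<close>. The power is holomorphic since \<open>z $ k - cnj (w $ k)\<close> lies in the upper half-plane.\<close>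
definition korenblum_kernel :: "real ^ 'n \<Rightarrow> complex ^ 'n \<Rightarrow> complex ^ 'n \<Rightarrow> complex" where
  "korenblum_kernel \<gamma> w z = (\<Prod>k\<in>UNIV. of_real (Im (w $ k) powr (\<gamma> $ k)) /
     (z $ k - cnj (w $ k)) powr of_real (2 * \<gamma> $ k))"

text \<open>A conformal map of the half-plane onto the disc sending \<open>w $ k\<close> to \<open>0\<close>, in the \<open>k\<close>-th variable.\<close>
definition blaschke_factor :: "complex ^ 'n \<Rightarrow> 'n \<Rightarrow> complex ^ 'n \<Rightarrow> complex" where
  "blaschke_factor w k z = (z $ k - w $ k) / (z $ k - cnj (w $ k))"

lemma diff_cnj_nonzero:
  assumes "Im u > 0" "Im v > 0" shows "u - cnj v \<noteq> 0"
  using assms by (auto simp: complex_eq_iff)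

lemma holomorphic_several_korenblum_kernel:
  assumes w: "w \<in> poly_upper_half"
  shows "holomorphic_several (korenblum_kernel \<gamma> w) poly_upper_half"
  unfolding korenblum_kernel_def[abs_def]
proof (rule holomorphic_several_prod)
  fix k
  have "(\<lambda>x. of_real (Im (w $ k) powr (\<gamma> $ k)) / (x - cnj (w $ k)) powr of_real (2 * \<gamma> $ k))
      holomorphic_on upper_half"
    by (intro holomorphic_intros)
      (use Im_pos[OF w, of k] in \<open>auto simp: upper_half_def complex_nonpos_Reals_iff powr_eq_0_iff diff_cnj_nonzero\<close>)
  then show "holomorphic_several (\<lambda>z. of_real (Im (w $ k) powr (\<gamma> $ k)) /
      (z $ k - cnj (w $ k)) powr of_real (2 * \<gamma> $ k)) poly_upper_half"
    by (rule holomorphic_several_coordinate)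
qed simp

lemma holomorphic_several_blaschke_factor:
  assumes w: "w \<in> poly_upper_half"
  shows "holomorphic_several (blaschke_factor w k) poly_upper_half"
proof -
  have "(\<lambda>x. (x - w $ k) / (x - cnj (w $ k))) holomorphic_on upper_half"
    by (intro holomorphic_intros)
      (use Im_pos[OF w, of k] in \<open>auto simp: upper_half_def complex_eq_iff\<close>)
  then show ?thesis
    unfolding blaschke_factor_def[abs_def] by (rule holomorphic_several_coordinate)
qed

lemma cmod_blaschke_factor: "cmod (blaschke_factor w k z) = pseudohyp (z $ k) (w $ k)"
  by (simp add: blaschke_factor_def pseudohyp_def)

lemma cmod_korenblum_kernel:
  assumes "w \<in> poly_upper_half"
  shows "cmod (korenblum_kernel \<gamma> w z) =
    (\<Prod>k\<in>UNIV. (Im (w $ k) / (cmod (z $ k - cnj (w $ k)))\<^sup>2) powr (\<gamma> $ k))"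
  unfolding korenblum_kernel_def prod_norm[symmetric]
proof (rule prod.cong)
  fix k
  define t where "t = cmod (z $ k - cnj (w $ k))"
  have "cmod (of_real (Im (w $ k) powr (\<gamma> $ k)) / (z $ k - cnj (w $ k)) powr of_real (2 * \<gamma> $ k))
      = Im (w $ k) powr (\<gamma> $ k) / t powr (2 * \<gamma> $ k)"
    by (simp add: norm_divide norm_powr_real_powr' t_def del: of_real_mult)
  also have "t powr (2 * \<gamma> $ k) = (t\<^sup>2) powr (\<gamma> $ k)"
    by (simp add: powr_powr[symmetric] t_def)
  finally show "cmod (of_real (Im (w $ k) powr (\<gamma> $ k)) /
      (z $ k - cnj (w $ k)) powr of_real (2 * \<gamma> $ k)) =
      (Im (w $ k) / (cmod (z $ k - cnj (w $ k)))\<^sup>2) powr (\<gamma> $ k)"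
    by (simp add: powr_divide t_def)
qed simp

lemma Im_mult_le_cmod_diff_cnj:
  assumes "Im u > 0" "Im v > 0" shows "Im v * Im u \<le> (cmod (u - cnj v))\<^sup>2"
proof -
  have "Im v * Im u \<le> (Im u + Im v)\<^sup>2"
    using assms by (simp add: power2_eq_square algebra_simps add_nonneg_nonneg)
  also have "\<dots> \<le> (cmod (u - cnj v))\<^sup>2"
    using assms by (intro power_mono cmod_diff_cnj_ge) auto
  finally show ?thesis .
qed

lemma korenblum_kernel_weight_le_1:
  assumes w: "w \<in> poly_upper_half" and z: "z \<in> poly_upper_half" and \<gamma>: "\<And>k. \<gamma> $ k \<ge> 0"
  shows "cmod (korenblum_kernel \<gamma> w z) * korenblum_weight \<gamma> z \<le> 1"
  unfolding cmod_korenblum_kernel[OF w] korenblum_weight_def prod.distrib[symmetric]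
proof (rule prod_le_1, intro conjI)
  fix k
  have *: "Im (w $ k) * Im (z $ k) \<le> (cmod (z $ k - cnj (w $ k)))\<^sup>2"
    by (intro Im_mult_le_cmod_diff_cnj Im_pos w z)
  have "(Im (w $ k) / (cmod (z $ k - cnj (w $ k)))\<^sup>2) powr \<gamma> $ k * Im (z $ k) powr \<gamma> $ k
      = (Im (w $ k) * Im (z $ k) / (cmod (z $ k - cnj (w $ k)))\<^sup>2) powr \<gamma> $ k"
    by (simp add: powr_mult[symmetric])
  also have "\<dots> \<le> 1"
    using * Im_pos[OF w, of k] Im_pos[OF z, of k] \<gamma>[of k]
    by (intro powr_le1) (auto simp: divide_le_eq_1)
  finally show "(Im (w $ k) / (cmod (z $ k - cnj (w $ k)))\<^sup>2) powr \<gamma> $ k * Im (z $ k) powr \<gamma> $ k \<le> 1" .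
qed simp

text \<open>Extension by zero is part of membership in the Korenblum space.\<close>
definition kernel_multiple ::
    "real ^ 'n \<Rightarrow> complex ^ 'n \<Rightarrow> (complex ^ 'n \<Rightarrow> complex) \<Rightarrow> complex ^ 'n \<Rightarrow> complex" where
  "kernel_multiple \<gamma> w g = (\<lambda>z. if z \<in> poly_upper_half then korenblum_kernel \<gamma> w z * g z else 0)"

lemma kernel_multiple_quantity_le_1:
  assumes w: "w \<in> poly_upper_half" and \<gamma>: "\<And>k. \<gamma> $ k \<ge> 0"
    and le: "cmod (g z) \<le> 1" and z: "z \<in> poly_upper_half"
  shows "korenblum_quantity \<gamma> (kernel_multiple \<gamma> w g) z \<le> 1"
proof -
  have "cmod (g z) * (cmod (korenblum_kernel \<gamma> w z) * korenblum_weight \<gamma> z) \<le> 1 * 1"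
    using korenblum_weight_pos[OF z, of \<gamma>]
    by (intro mult_mono korenblum_kernel_weight_le_1 w z \<gamma> le) auto
  then show ?thesis
    using z by (simp add: korenblum_quantity_eq kernel_multiple_def norm_mult mult_ac)
qed

lemma kernel_multiple_in_space:
  assumes w: "w \<in> poly_upper_half" and \<gamma>: "\<And>k. \<gamma> $ k \<ge> 0"
    and g: "holomorphic_several g poly_upper_half"
    and le: "\<And>z. z \<in> poly_upper_half \<Longrightarrow> cmod (g z) \<le> 1"
  shows "kernel_multiple \<gamma> w g \<in> korenblum_space \<gamma>"
proof -
  have "holomorphic_several (\<lambda>z. korenblum_kernel \<gamma> w z * g z) poly_upper_half"
    by (intro holomorphic_several_mult holomorphic_several_korenblum_kernel w g)
  then have "holomorphic_several (kernel_multiple \<gamma> w g) poly_upper_half"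
    by (rule holomorphic_several_transform[OF open_poly_upper_half])
      (simp add: kernel_multiple_def)
  moreover have "bdd_above (korenblum_quantity \<gamma> (kernel_multiple \<gamma> w g) ` poly_upper_half)"
    using kernel_multiple_quantity_le_1[where g = g, OF w \<gamma> le] by (intro bdd_aboveI2[where M = 1]) auto
  ultimately show ?thesis by (simp add: korenblum_space_def kernel_multiple_def)
qed

lemma cmod_blaschke_factor_le_1:
  "w \<in> poly_upper_half \<Longrightarrow> z \<in> poly_upper_half \<Longrightarrow> cmod (blaschke_factor w k z) \<le> 1"
  by (simp add: cmod_blaschke_factor pseudohyp_le_1 Im_pos)

text \<open>The two test functions \<open>K\<close> and \<open>K * b\<close> together recover the increment of the bounded factor \<open>b\<close>:
  \<open>K u * (b u - b v) = (K u * b u - K v * b v) - b v * (K u - K v)\<close>. With \<open>w = u\<close> this is the tool for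
  necessity of the boundary condition, with \<open>w\<close> a fixed point the one for sufficiency.\<close>
lemma kernel_separates:
  assumes "u \<in> poly_upper_half" "v \<in> poly_upper_half" "w \<in> poly_upper_half"
  shows "cmod (korenblum_kernel \<gamma> w u) * cmod (blaschke_factor w k u - blaschke_factor w k v)
    \<le> cmod (kernel_multiple \<gamma> w (blaschke_factor w k) u - kernel_multiple \<gamma> w (blaschke_factor w k) v)
      + cmod (kernel_multiple \<gamma> w (\<lambda>_. 1) u - kernel_multiple \<gamma> w (\<lambda>_. 1) v)"
proof -
  let ?K = "korenblum_kernel \<gamma> w" and ?b = "blaschke_factor w k"
  have "?K u * (?b u - ?b v) = (?K u * ?b u - ?K v * ?b v) - ?b v * (?K u - ?K v)"
    by (simp add: algebra_simps)
  then have "cmod (?K u) * cmod (?b u - ?b v)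
      \<le> cmod (?K u * ?b u - ?K v * ?b v) + cmod (?b v) * cmod (?K u - ?K v)"
    by (metis norm_mult norm_triangle_ineq4)
  also have "cmod (?b v) * cmod (?K u - ?K v) \<le> 1 * cmod (?K u - ?K v)"
    by (intro mult_right_mono cmod_blaschke_factor_le_1 assms) auto
  finally show ?thesis using assms by (simp add: kernel_multiple_def)
qed

section \<open>Estimates for the difference of two composition operators\<close>

text \<open>Under the Cayley transform to the disc, \<open>pseudohyp u v\<close> becomes
  \<open>cmod ((p - q) / (1 - cnj q * p))\<close> for the images \<open>p\<close> and \<open>q\<close>. As long as \<open>u\<close> stays in a compact set, \<open>p\<close>
  stays away from the unit circle and the denominator is bounded below, uniformly in \<open>q\<close>; the
  constants make this explicit without leaving the half-plane.\<close>
lemma pseudohyp_le_cayley: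
  assumes a: "0 < a" "a \<le> Im u" and b: "cmod u \<le> b" and v: "Im v > 0"
  shows "pseudohyp u v \<le> (b + 1) * (1 + (b + 1) / a) *
    cmod ((u - \<i>) / (u - cnj \<i>) - (v - \<i>) / (v - cnj \<i>))"
proof -
  have nz: "u + \<i> \<noteq> 0" "v + \<i> \<noteq> 0"
    using diff_cnj_nonzero[of u \<i>] diff_cnj_nonzero[of v \<i>] a v by auto
  define d where "d = cmod (u - cnj v)"
  have d: "a \<le> d" using cmod_diff_cnj_ge[of u v] a v by (simp add: d_def)
  have b1: "cmod (u + \<i>) \<le> b + 1" "cmod (u - \<i>) \<le> b + 1"
    using b norm_triangle_ineq[of u \<i>] norm_triangle_ineq4[of u \<i>] by auto
  have b0: "b + 1 \<ge> 0" using b1(1) norm_ge_zero order_trans by blast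
  have "cmod (v + \<i>) = cmod (cnj (v + \<i>))" by (simp only: complex_mod_cnj)
  also have "cnj (v + \<i>) = (u - \<i>) - (u - cnj v)" by simp
  also have "cmod \<dots> \<le> (b + 1) + d"
    using norm_triangle_ineq4[of "u - \<i>" "u - cnj v"] b1 by (simp add: d_def)
  also have "\<dots> \<le> (b + 1) * (d / a) + d"
    using d a b0 mult_left_mono[of 1 "d / a" "b + 1"] by (simp add: le_divide_eq_1)
  also have "\<dots> = (1 + (b + 1) / a) * d" by (simp add: algebra_simps)
  finally have vi: "cmod (v + \<i>) \<le> (1 + (b + 1) / a) * d" .
  have "cmod (u + \<i>) * cmod (v + \<i>) \<le> (b + 1) * ((1 + (b + 1) / a) * d)"
    using b1 vi b0 by (intro mult_mono) auto
  also have "\<dots> \<le> 2 * ((b + 1) * (1 + (b + 1) / a) * d)"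
    using b0 a d by (simp add: mult.assoc)
  finally have prod_le: "cmod (u + \<i>) * cmod (v + \<i>) \<le> 2 * ((b + 1) * (1 + (b + 1) / a) * d)" .
  have "(u - \<i>) / (u - cnj \<i>) - (v - \<i>) / (v - cnj \<i>) = 2 * \<i> * (u - v) / ((u + \<i>) * (v + \<i>))"
    using nz by (simp add: field_simps)
  then have eq: "cmod ((u - \<i>) / (u - cnj \<i>) - (v - \<i>) / (v - cnj \<i>))
      = 2 * cmod (u - v) / (cmod (u + \<i>) * cmod (v + \<i>))"
    by (simp add: norm_divide norm_mult)
  have pos: "cmod (u + \<i>) * cmod (v + \<i>) > 0" using nz by simp
  have "cmod (u - v) * (cmod (u + \<i>) * cmod (v + \<i>)) \<le>
      cmod (u - v) * (2 * ((b + 1) * (1 + (b + 1) / a) * d))"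
    using prod_le by (rule mult_left_mono) simp
  then have "cmod (u - v) / d \<le> (b + 1) * (1 + (b + 1) / a) * (2 * cmod (u - v) / (cmod (u + \<i>) * cmod (v + \<i>)))"
    using pos d a by (simp add: field_simps)
  then show ?thesis unfolding eq by (simp add: pseudohyp_def norm_divide d_def)
qed

text \<open>The finitely many test functions \<open>K\<close> and \<open>K * b\<^sub>k\<close> for the base point with all coordinates \<open>\<i>\<close>
  suffice: their images under the difference operator have finite weighted sup norms, \<open>K\<close> is bounded
  below on the box, and some \<open>b\<^sub>k\<close> separates \<open>\<phi> z\<close> from \<open>\<psi> z\<close> as well as
  \<open>pseudohyp\<close> does, up to a constant. Multiplying the
  separation inequality by the weight therefore gives the claim.\<close>
lemma pseudohyp_weight_bounded_on_box:
  fixes \<phi> \<psi> :: "complex ^ 'n \<Rightarrow> complex ^ 'n" and \<gamma> :: "real ^ 'n"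
  assumes \<phi>: "\<And>z. z \<in> poly_upper_half \<Longrightarrow> \<phi> z \<in> poly_upper_half"
    and \<psi>: "\<And>z. z \<in> poly_upper_half \<Longrightarrow> \<psi> z \<in> poly_upper_half"
    and \<gamma>: "\<And>k. \<gamma> $ k \<ge> 0" and a: "a > 0"
    and bounded: "\<And>f. f \<in> korenblum_space \<gamma> \<Longrightarrow>
      \<exists>B. \<forall>z\<in>poly_upper_half. cmod (f (\<phi> z) - f (\<psi> z)) * korenblum_weight \<gamma> z \<le> B"
  obtains C where "C \<ge> 0" "\<And>z. z \<in> poly_upper_half \<Longrightarrow> \<phi> z \<in> half_plane_box a b \<Longrightarrow>
    poly_pseudohyp (\<phi> z) (\<psi> z) * korenblum_weight \<gamma> z \<le> C"
proof -
  define w :: "complex ^ 'n" where "w = (\<chi> k. \<i>)"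
  have w: "w \<in> poly_upper_half" by (intro poly_upper_halfI) (simp add: w_def)
  let ?K = "korenblum_kernel \<gamma> w" and ?b = "blaschke_factor w"
  define \<kappa> where "\<kappa> = (\<Prod>k\<in>UNIV. (1 / (\<bar>b\<bar> + 1)\<^sup>2) powr (\<gamma> $ k))"
  have "1 / (\<bar>b\<bar> + 1)\<^sup>2 \<noteq> 0" by (smt (verit) divide_eq_0_iff zero_less_power2)
  then have \<kappa>: "\<kappa> > 0" unfolding \<kappa>_def by (intro prod_pos) (metis powr_gt_zero)
  define c where "c = (\<bar>b\<bar> + 1) * (1 + (\<bar>b\<bar> + 1) / a)"
  have b_pos: "\<bar>b\<bar> + 1 > 0" by linarith
  have c: "c > 0" unfolding c_def
    by (intro mult_pos_pos[OF b_pos] add_pos_pos[OF zero_less_one] divide_pos_pos[OF b_pos a])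
  have nonneg_bound:
    "\<exists>B\<ge>0. \<forall>z\<in>poly_upper_half. cmod (f (\<phi> z) - f (\<psi> z)) * korenblum_weight \<gamma> z \<le> B"
    if "f \<in> korenblum_space \<gamma>" for f
    using bounded[OF that] by (meson abs_ge_self abs_ge_zero order_trans)
  have one: "kernel_multiple \<gamma> w (\<lambda>_. 1) \<in> korenblum_space \<gamma>"
    by (intro kernel_multiple_in_space holomorphic_several_const w \<gamma>) simp
  have blaschke: "kernel_multiple \<gamma> w (?b k) \<in> korenblum_space \<gamma>" for k
    by (intro kernel_multiple_in_space holomorphic_several_blaschke_factor cmod_blaschke_factor_le_1 w \<gamma>)
  obtain B0 where B0: "B0 \<ge> 0"
    "\<And>z. z \<in> poly_upper_half \<Longrightarrow> cmod (kernel_multiple \<gamma> w (\<lambda>_. 1) (\<phi> z) -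
       kernel_multiple \<gamma> w (\<lambda>_. 1) (\<psi> z)) * korenblum_weight \<gamma> z \<le> B0"
    using nonneg_bound[OF one] by blast
  have "\<forall>k. \<exists>B\<ge>0. \<forall>z\<in>poly_upper_half. cmod (kernel_multiple \<gamma> w (?b k) (\<phi> z) -
       kernel_multiple \<gamma> w (?b k) (\<psi> z)) * korenblum_weight \<gamma> z \<le> B"
    using nonneg_bound[OF blaschke] by blast
  then obtain B where B: "\<And>k. B k \<ge> 0"
    "\<And>z k. z \<in> poly_upper_half \<Longrightarrow> cmod (kernel_multiple \<gamma> w (?b k) (\<phi> z) -
       kernel_multiple \<gamma> w (?b k) (\<psi> z)) * korenblum_weight \<gamma> z \<le> B k"
    unfolding choice_iff by blast
  show thesis
  proof (rule that)
    show "c * ((\<Sum>k\<in>UNIV. B k) + B0) / \<kappa> \<ge> 0"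
      using c \<kappa> B B0 by (intro divide_nonneg_pos mult_nonneg_nonneg add_nonneg_nonneg sum_nonneg) auto
    fix z assume z: "z \<in> poly_upper_half" and box: "\<phi> z \<in> half_plane_box a b"
    define u v where "u = \<phi> z" and "v = \<psi> z"
    have uv: "u \<in> poly_upper_half" "v \<in> poly_upper_half" using \<phi> \<psi> z by (auto simp: u_def v_def)
    have u: "a \<le> Im (u $ k)" "cmod (u $ k) \<le> \<bar>b\<bar>" for k
      using box by (auto simp: half_plane_box_def u_def intro: order_trans[OF _ abs_ge_self])
    obtain k where k: "poly_pseudohyp u v = pseudohyp (u $ k) (v $ k)"
      using poly_pseudohyp_attained by blast
    have W: "korenblum_weight \<gamma> z > 0" by (rule korenblum_weight_pos[OF z])
    have "\<kappa> \<le> cmod (?K u)"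
      unfolding \<kappa>_def cmod_korenblum_kernel[OF w]
    proof (rule prod_mono, intro conjI)
      fix k
      have "cmod (u $ k + \<i>) \<le> \<bar>b\<bar> + 1" using norm_triangle_ineq[of "u $ k" \<i>] u(2)[of k] by simp
      moreover have "cmod (u $ k + \<i>) > 0"
        using diff_cnj_nonzero[of "u $ k" \<i>] Im_pos[OF uv(1)] by simp
      ultimately show "(1 / (\<bar>b\<bar> + 1)\<^sup>2) powr \<gamma> $ k
          \<le> (Im (w $ k) / (cmod (u $ k - cnj (w $ k)))\<^sup>2) powr \<gamma> $ k"
        by (intro powr_mono2 \<gamma>) (auto simp: w_def intro!: divide_left_mono power_mono mult_pos_pos)
    qed simp
    then have "\<kappa> * cmod (?b k u - ?b k v) \<le> cmod (?K u) * cmod (?b k u - ?b k v)"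
      by (rule mult_right_mono) simp
    also note kernel_separates[OF uv w]
    finally have "\<kappa> * cmod (?b k u - ?b k v) * korenblum_weight \<gamma> z \<le> B k + B0"
      using B0(2)[OF z] B(2)[OF z, of k] mult_right_mono[OF _ less_imp_le[OF W]]
      unfolding u_def[symmetric] v_def[symmetric] by (smt (verit) distrib_right)
    moreover have "B k \<le> (\<Sum>k\<in>UNIV. B k)" using B(1) by (intro member_le_sum) auto
    ultimately have sum: "\<kappa> * cmod (?b k u - ?b k v) * korenblum_weight \<gamma> z \<le> (\<Sum>k\<in>UNIV. B k) + B0"
      by linarith
    have "poly_pseudohyp u v \<le> c * cmod (?b k u - ?b k v)"
      unfolding k c_def blaschke_factor_def w_def vec_lambda_beta
      by (rule pseudohyp_le_cayley[OF a u Im_pos[OF uv(2)]])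
    then have "\<kappa> * poly_pseudohyp u v * korenblum_weight \<gamma> z \<le>
        \<kappa> * (c * cmod (?b k u - ?b k v)) * korenblum_weight \<gamma> z"
      using \<kappa> W by (intro mult_right_mono mult_left_mono) auto
    also have "\<dots> \<le> c * ((\<Sum>k\<in>UNIV. B k) + B0)"
      using mult_left_mono[OF sum, of c] c by (simp add: mult_ac)
    finally show "poly_pseudohyp (\<phi> z) (\<psi> z) * korenblum_weight \<gamma> z
        \<le> c * ((\<Sum>k\<in>UNIV. B k) + B0) / \<kappa>"
      using \<kappa> by (simp add: u_def v_def field_simps)
  qed
qed

lemma half_polydisc_subset_box:
  assumes "u \<in> half_plane_box a b"
  shows "half_polydisc u \<subseteq> half_plane_box (a / 2) (2 * b)"
proof
  fix z assume z: "z \<in> half_polydisc u"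
  have u: "a \<le> Im (u $ k)" "cmod (u $ k) \<le> b" for k using assms by (auto simp: half_plane_box_def)
  have "a / 2 \<le> Im (z $ k) \<and> cmod (z $ k) \<le> 2 * b" for k
  proof
    show "a / 2 \<le> Im (z $ k)" using half_polydisc_Im[OF z, of k] u(1)[of k] by linarith
    have "cmod (z $ k - u $ k) \<le> Im (u $ k) / 2" using z by (simp add: half_polydisc_def)
    moreover have "cmod (z $ k) \<le> cmod (u $ k) + cmod (z $ k - u $ k)" by (rule norm_triangle_sub)
    moreover have "Im (u $ k) \<le> cmod (u $ k)" using abs_Im_le_cmod[of "u $ k"] by linarith
    ultimately show "cmod (z $ k) \<le> 2 * b" using u(2)[of k] norm_ge_zero[of "u $ k"] by linarith
  qed
  then show "z \<in> half_plane_box (a / 2) (2 * b)" by (simp add: half_plane_box_def)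
qed

lemma half_plane_box_subset_double:
  assumes "a > 0" shows "half_plane_box a b \<subseteq> half_plane_box (a / 2) (2 * b)"
proof
  fix u :: "complex ^ 'n" assume u: "u \<in> half_plane_box a b"
  then have "u \<in> half_polydisc u"
    using half_plane_box_subset[OF assms] Im_pos by (fastforce simp: half_polydisc_def intro: less_imp_le)
  then show "u \<in> half_plane_box (a / 2) (2 * b)" using half_polydisc_subset_box[OF u] by blast
qed

lemma korenblum_quantity_comp_op_diff:
  assumes "z \<in> poly_upper_half"
  shows "korenblum_quantity \<gamma> ((comp_op \<phi> - comp_op \<psi>) f) z
    = cmod (f (\<phi> z) - f (\<psi> z)) * korenblum_weight \<gamma> z"
  using assms by (simp add: korenblum_quantity_eq comp_op_def)

text \<open>The operator has arbitrarily small norm up to a multiple of the sup norm over a compact set. By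
  Montel's theorem, a difference of composition operators that acts on the space then maps bounded sets to relatively compact ones.\<close>
definition controlled_on_boxes ::
    "real ^ 'n \<Rightarrow> ((complex ^ 'n \<Rightarrow> complex) \<Rightarrow> complex ^ 'n \<Rightarrow> complex) \<Rightarrow> bool" where
  "controlled_on_boxes \<gamma> T \<longleftrightarrow>
     (\<forall>\<epsilon>>0. \<exists>a>0. \<exists>b. \<exists>C\<ge>0. \<forall>f\<in>korenblum_space \<gamma>. \<forall>A\<ge>0. \<forall>\<eta>\<ge>0.
        (\<forall>x\<in>poly_upper_half. korenblum_quantity \<gamma> f x \<le> A) \<longrightarrow>
        (\<forall>x\<in>half_plane_box a b. cmod (f x) \<le> \<eta>) \<longrightarrow>
        (\<forall>z\<in>poly_upper_half. korenblum_quantity \<gamma> (T f) z \<le> \<epsilon> * A + C * \<eta>))"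

text \<open>Choose a box outside of which both boundary quantities are below \<open>e\<close>, and write \<open>u = \<phi> z\<close>,
  \<open>v = \<psi> z\<close>, \<open>\<rho>\<close> for their distance. If \<open>\<rho>\<close> is small, \<open>f u - f v\<close> is \<open>\<rho>\<close> times a bound for \<open>f\<close> near
  \<open>u\<close>: for \<open>u\<close> in the box this bound is \<open>\<eta>\<close>, and \<open>\<rho> * korenblum_weight \<gamma> z\<close> is bounded; for \<open>u\<close> outside
  it is a multiple of \<open>A / korenblum_weight \<gamma> u\<close>, and the boundary condition applies. If \<open>\<rho>\<close> is not
  small, \<open>f u\<close> and \<open>f v\<close> are estimated separately in the same way, at the price of a factor \<open>8 * \<rho> \<ge> 1\<close>.\<close>
lemma difference_controlled_on_boxes:
  fixes \<phi> \<psi> :: "complex ^ 'n \<Rightarrow> complex ^ 'n" and \<gamma> :: "real ^ 'n"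
  assumes \<phi>: "\<And>z. z \<in> poly_upper_half \<Longrightarrow> \<phi> z \<in> poly_upper_half"
    and \<psi>: "\<And>z. z \<in> poly_upper_half \<Longrightarrow> \<psi> z \<in> poly_upper_half"
    and \<gamma>: "\<And>k. \<gamma> $ k \<ge> 0"
    and bounded: "\<And>f. f \<in> korenblum_space \<gamma> \<Longrightarrow>
      \<exists>B. \<forall>z\<in>poly_upper_half. cmod (f (\<phi> z) - f (\<psi> z)) * korenblum_weight \<gamma> z \<le> B"
    and lim_\<phi>: "boundary_limit_zero \<phi> (\<lambda>z. poly_pseudohyp (\<phi> z) (\<psi> z) *
      (korenblum_weight \<gamma> z / korenblum_weight \<gamma> (\<phi> z)))"
    and lim_\<psi>: "boundary_limit_zero \<psi> (\<lambda>z. poly_pseudohyp (\<phi> z) (\<psi> z) *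
      (korenblum_weight \<gamma> z / korenblum_weight \<gamma> (\<psi> z)))"
  shows "controlled_on_boxes \<gamma> (comp_op \<phi> - comp_op \<psi>)"
  unfolding controlled_on_boxes_def
proof (intro allI impI)
  fix \<epsilon> :: real assume \<epsilon>: "\<epsilon> > 0"
  let ?W = "korenblum_weight \<gamma>"
  define c where "c = (\<Prod>k\<in>UNIV. (2 :: real) powr (\<gamma> $ k))"
  have c: "c > 0" unfolding c_def by (intro prod_pos) simp
  \<comment> \<open>The first summand pays for close points, the second for distant ones.\<close>
  define e where "e = \<epsilon> / (16 * c + 16)"
  have e: "e > 0" using c \<epsilon> by (simp add: e_def)
  have ee: "16 * c * e \<le> \<epsilon>" "16 * e \<le> \<epsilon>" using c \<epsilon> by (auto simp: e_def field_simps)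
  obtain \<Omega>1 where \<Omega>1: "compact \<Omega>1" "\<Omega>1 \<subseteq> poly_upper_half"
    "\<And>z. \<lbrakk>z \<in> poly_upper_half; \<phi> z \<notin> \<Omega>1\<rbrakk> \<Longrightarrow> poly_pseudohyp (\<phi> z) (\<psi> z) * (?W z / ?W (\<phi> z)) < e"
    using lim_\<phi> e \<phi> unfolding boundary_limit_zero_def by (metis DiffI)
  obtain \<Omega>2 where \<Omega>2: "compact \<Omega>2" "\<Omega>2 \<subseteq> poly_upper_half"
    "\<And>z. \<lbrakk>z \<in> poly_upper_half; \<psi> z \<notin> \<Omega>2\<rbrakk> \<Longrightarrow> poly_pseudohyp (\<phi> z) (\<psi> z) * (?W z / ?W (\<psi> z)) < e"
    using lim_\<psi> e \<psi> unfolding boundary_limit_zero_def by (metis DiffI)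
  obtain a b where a: "a > 0" and box: "\<Omega>1 \<union> \<Omega>2 \<subseteq> half_plane_box a b"
    using compact_subset_half_plane_box[OF compact_Un[OF \<Omega>1(1) \<Omega>2(1)]] \<Omega>1(2) \<Omega>2(2) by blast
  obtain C1 where C1: "C1 \<ge> 0" "\<And>z. \<lbrakk>z \<in> poly_upper_half; \<phi> z \<in> half_plane_box a b\<rbrakk> \<Longrightarrow>
      poly_pseudohyp (\<phi> z) (\<psi> z) * ?W z \<le> C1"
    by (rule pseudohyp_weight_bounded_on_box[of \<phi> \<psi> \<gamma> a b]) (use \<phi> \<psi> \<gamma> a bounded in auto)
  obtain C2 where C2: "C2 \<ge> 0" "\<And>z. \<lbrakk>z \<in> poly_upper_half; \<psi> z \<in> half_plane_box a b\<rbrakk> \<Longrightarrow>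
      poly_pseudohyp (\<psi> z) (\<phi> z) * ?W z \<le> C2"
    by (rule pseudohyp_weight_bounded_on_box[of \<psi> \<phi> \<gamma> a b])
      (use \<phi> \<psi> \<gamma> a bounded in \<open>auto simp: norm_minus_commute\<close>)
  define C where "C = max C1 C2"
  have C: "C \<ge> 0" using C1 by (simp add: C_def)
  show "\<exists>a>0. \<exists>b. \<exists>C\<ge>0. \<forall>f\<in>korenblum_space \<gamma>. \<forall>A\<ge>0. \<forall>\<eta>\<ge>0.
      (\<forall>x\<in>poly_upper_half. korenblum_quantity \<gamma> f x \<le> A) \<longrightarrow>
      (\<forall>x\<in>half_plane_box a b. cmod (f x) \<le> \<eta>) \<longrightarrow>
      (\<forall>z\<in>poly_upper_half. korenblum_quantity \<gamma> ((comp_op \<phi> - comp_op \<psi>) f) z \<le> \<epsilon> * A + C * \<eta>)"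
  proof (intro exI conjI ballI allI impI)
    show "a / 2 > 0" "16 * C \<ge> 0" using a C by auto
    fix f :: "complex ^ 'n \<Rightarrow> complex" and A \<eta> :: real and z :: "complex ^ 'n"
    assume fS: "f \<in> korenblum_space \<gamma>" and A: "\<forall>x\<in>poly_upper_half. korenblum_quantity \<gamma> f x \<le> A" "A \<ge> 0"
      and \<eta>: "\<forall>x\<in>half_plane_box (a / 2) (2 * b). cmod (f x) \<le> \<eta>" "\<eta> \<ge> 0"
      and z: "z \<in> poly_upper_half"
    have f: "holomorphic_several f poly_upper_half" using fS by (simp add: korenblum_space_def)
    have A_le: "cmod (f x) * ?W x \<le> A" if "x \<in> poly_upper_half" for x
      using A(1) that by (simp add: korenblum_quantity_eq)
    define u v \<rho> where "u = \<phi> z" and "v = \<psi> z" and "\<rho> = poly_pseudohyp u v"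
    have uv: "u \<in> poly_upper_half" "v \<in> poly_upper_half" using \<phi> \<psi> z by (auto simp: u_def v_def)
    have Wz: "?W z > 0" and Wu: "?W u > 0" using korenblum_weight_pos z uv by auto
    have \<rho>: "\<rho> \<ge> 0" by (simp add: \<rho>_def poly_pseudohyp_nonneg)
    have in_u: "\<rho> * ?W z \<le> C" if "u \<in> half_plane_box a b"
      using C1(2)[OF z] that by (simp add: u_def v_def \<rho>_def C_def)
    have in_v: "\<rho> * ?W z \<le> C" if "v \<in> half_plane_box a b"
      using C2(2)[OF z] that by (simp add: u_def v_def \<rho>_def C_def poly_pseudohyp_commute)
    have out_u: "\<rho> * (?W z / ?W u) \<le> e" if "u \<notin> half_plane_box a b"
      using \<Omega>1(3)[OF z] that box by (auto simp: u_def v_def \<rho>_def intro: less_imp_le)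
    have out_v: "\<rho> * (?W z / ?W v) \<le> e" if "v \<notin> half_plane_box a b"
      using \<Omega>2(3)[OF z] that box by (auto simp: u_def v_def \<rho>_def intro: less_imp_le)
    have "cmod (f u - f v) * ?W z \<le> \<epsilon> * A + 16 * C * \<eta>"
    proof (cases "\<rho> < 1 / 8")
      case True
      show ?thesis
      proof (cases "u \<in> half_plane_box a b")
        case u: True
        have "cmod (f u - f v) \<le> 16 * \<eta> * \<rho>"
          unfolding \<rho>_def
          by (rule pseudohyp_lipschitz[OF f uv])
            (use True \<eta> half_polydisc_subset_box[OF u] in \<open>auto simp: \<rho>_def\<close>)
        then have "cmod (f u - f v) * ?W z \<le> 16 * \<eta> * \<rho> * ?W z"
          using Wz by (intro mult_right_mono) auto
        also have "\<dots> \<le> 16 * C * \<eta>"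
          using mult_left_mono[OF in_u[OF u] \<eta>(2)] by (simp add: mult_ac)
        finally show ?thesis using \<epsilon> A(2) by (simp add: add_increasing)
      next
        case u: False
        have "cmod (f x) \<le> c * A / ?W u" if x: "x \<in> half_polydisc u" for x
        proof -
          have xH: "x \<in> poly_upper_half" using half_polydisc_subset[OF uv(1)] x by blast
          have "?W u \<le> c * ?W x" unfolding c_def
          proof (rule korenblum_weight_le)
            show "Im (u $ k) \<le> 2 * Im (x $ k)" for k using half_polydisc_Im[OF x, of k] by linarith
          qed (use \<gamma> Im_pos[OF uv(1)] xH in \<open>auto intro: less_imp_le\<close>)
          then have "cmod (f x) * ?W u \<le> cmod (f x) * (c * ?W x)" by (rule mult_left_mono) simp
          also have "\<dots> \<le> c * A" using mult_left_mono[OF A_le[OF xH], of c] c by (simp add: mult_ac)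
          finally show ?thesis using Wu by (simp add: field_simps)
        qed
        then have "cmod (f u - f v) \<le> 16 * (c * A / ?W u) * \<rho>"
          unfolding \<rho>_def by (intro pseudohyp_lipschitz[OF f uv]) (use True in \<open>auto simp: \<rho>_def\<close>)
        then have "cmod (f u - f v) * ?W z \<le> 16 * (c * A / ?W u) * \<rho> * ?W z"
          using Wz by (intro mult_right_mono) auto
        also have "\<dots> = 16 * c * A * (\<rho> * (?W z / ?W u))" by simp
        also have "\<dots> \<le> 16 * c * A * e"
          using out_u[OF u] c A(2) by (intro mult_left_mono) auto
        also have "\<dots> \<le> \<epsilon> * A" using mult_right_mono[OF ee(1) A(2)] by (simp add: mult_ac)
        finally show ?thesis using C \<eta>(2) by (simp add: add_increasing2)
      qed
    next
      case False
      then have \<rho>8: "1 \<le> 8 * \<rho>" by simp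
      have far: "cmod (f x) * ?W z \<le> 8 * e * A + 8 * C * \<eta>"
        if xH: "x \<in> poly_upper_half"
          and inside: "x \<in> half_plane_box a b \<Longrightarrow> \<rho> * ?W z \<le> C"
          and outside: "x \<notin> half_plane_box a b \<Longrightarrow> \<rho> * (?W z / ?W x) \<le> e" for x
      proof (cases "x \<in> half_plane_box a b")
        case True
        have "cmod (f x) * ?W z \<le> \<eta> * (8 * \<rho> * ?W z)"
          using \<eta>(1) half_plane_box_subset_double[OF a] True \<rho>8 Wz \<eta>(2)
            mult_right_mono[OF \<rho>8, of "?W z"]
          by (intro mult_mono) auto
        also have "\<dots> \<le> 8 * C * \<eta>" using mult_left_mono[OF inside[OF True] \<eta>(2)] by (simp add: mult_ac)
        finally show ?thesis using e A(2) by (simp add: add_increasing)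
      next
        case out: False
        have Wx: "?W x > 0" by (rule korenblum_weight_pos[OF xH])
        have "cmod (f x) * ?W z = (cmod (f x) * ?W x) * (1 * (?W z / ?W x))" using Wx by simp
        also have "\<dots> \<le> A * (8 * \<rho> * (?W z / ?W x))"
          using A_le A(2) xH \<rho>8 Wx Wz by (intro mult_mono mult_right_mono) auto
        also have "\<dots> = 8 * A * (\<rho> * (?W z / ?W x))" by simp
        also have "\<dots> \<le> 8 * A * e" using outside[OF out] A(2) by (intro mult_left_mono) auto
        finally show ?thesis using C \<eta>(2) by (simp add: add_increasing2 mult_ac)
      qed
      have "cmod (f u - f v) * ?W z \<le> (cmod (f u) + cmod (f v)) * ?W z"
        using Wz by (intro mult_right_mono norm_triangle_ineq4) auto
      also have "\<dots> \<le> 16 * e * A + 16 * C * \<eta>"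
        using far[OF uv(1) in_u out_u] far[OF uv(2) in_v out_v] by (simp add: distrib_right)
      also have "\<dots> \<le> \<epsilon> * A + 16 * C * \<eta>" using mult_right_mono[OF ee(2) A(2)] by simp
      finally show ?thesis .
    qed
    then show "korenblum_quantity \<gamma> ((comp_op \<phi> - comp_op \<psi>) f) z \<le> \<epsilon> * A + 16 * C * \<eta>"
      unfolding korenblum_quantity_comp_op_diff[OF z] u_def v_def .
  qed
qed

section \<open>Kernels at the boundary\<close>

text \<open>The modulus is the product of the factors \<open>q\<close>, raised to \<open>\<gamma>\<close>, with
  \<open>q = Im w / (cmod (x - cnj w))\<^sup>2\<close> in each variable. Every factor is bounded for fixed \<open>x\<close>, and outside
  a large box at least one of them is small: \<open>q \<le> Im w / (Im x)\<^sup>2\<close> serves if \<open>w\<close> is near the real axis, and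
  \<open>q \<le> 1 / cmod (x - cnj w)\<close> if \<open>w\<close> is large.\<close>
lemma korenblum_kernel_tendsto_0:
  fixes w :: "nat \<Rightarrow> complex ^ 'n"
  assumes w: "\<And>j. w j \<in> poly_upper_half"
    and out: "\<And>j. w j \<notin> half_plane_box (1 / real (Suc j)) (real (Suc j))"
    and \<gamma>: "\<And>k. \<gamma> $ k > 0" and x: "x \<in> poly_upper_half"
  shows "(\<lambda>j. korenblum_kernel \<gamma> (w j) x) \<longlonglongrightarrow> 0"
proof -
  define q where "q = (\<lambda>j k. Im (w j $ k) / (cmod (x $ k - cnj (w j $ k)))\<^sup>2)"
  have xk: "Im (x $ k) > 0" and wk: "Im (w j $ k) > 0" for j k using Im_pos x w by auto
  have cmod_pos: "cmod (x $ k - cnj (w j $ k)) > 0" for j k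
    using diff_cnj_nonzero[OF xk wk] by simp
  have q0: "q j k \<ge> 0" for j k using wk[of j k] by (simp add: q_def)
  have q_le: "q j k \<le> 1 / Im (x $ k)" for j k
    using Im_mult_le_cmod_diff_cnj[OF xk[of k] wk[of j k]] cmod_pos[of k j] xk[of k]
    by (simp add: q_def field_simps)
  \<comment> \<open>A bound for the \<open>k\<close>-th factor that is valid for either way of leaving the box in that coordinate.\<close>
  define s where "s = (\<lambda>j k. 1 / real (Suc j) / (Im (x $ k))\<^sup>2 + 1 / (real (Suc j) - cmod (x $ k)))"
  define Q where "Q = (\<lambda>k. \<Prod>l\<in>UNIV - {k}. (1 / Im (x $ l)) powr (\<gamma> $ l))"
  have Q: "Q k \<ge> 0" for k by (simp add: Q_def prod_nonneg)
  have s_pos: "0 \<le> s j k" if "real j > cmod (x $ k)" for j k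
    using that unfolding s_def by (intro add_nonneg_nonneg divide_nonneg_nonneg) auto
  have small: "\<exists>k. q j k \<le> s j k" if j: "\<And>k. real j > cmod (x $ k)" for j
  proof -
    obtain k where k: "Im (w j $ k) < 1 / real (Suc j) \<or> cmod (w j $ k) > real (Suc j)"
      using out[of j] by (auto simp: half_plane_box_def not_le)
    have summands: "1 / real (Suc j) / (Im (x $ k))\<^sup>2 \<ge> 0" "1 / (real (Suc j) - cmod (x $ k)) \<ge> 0"
      using j[of k] by auto
    from k have "q j k \<le> s j k"
    proof
      assume small: "Im (w j $ k) < 1 / real (Suc j)"
      have "Im (x $ k) \<le> cmod (x $ k - cnj (w j $ k))"
        using cmod_diff_cnj_ge[of "x $ k" "w j $ k"] wk[of j k] by linarith
      then have "q j k \<le> 1 / real (Suc j) / (Im (x $ k))\<^sup>2"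
        unfolding q_def using small wk[of j k] xk[of k] by (intro frac_le power_mono) auto
      then show ?thesis using summands(2) unfolding s_def by linarith
    next
      assume large: "cmod (w j $ k) > real (Suc j)"
      have Im_le: "Im (w j $ k) \<le> cmod (x $ k - cnj (w j $ k))"
        using cmod_diff_cnj_ge[of "x $ k" "w j $ k"] xk[of k] by linarith
      have "cmod (w j $ k) - cmod (x $ k) \<le> cmod (x $ k - cnj (w j $ k))"
        using norm_triangle_ineq2[of "cnj (w j $ k)" "x $ k"] by (simp add: norm_minus_commute)
      then have le: "real (Suc j) - cmod (x $ k) \<le> cmod (x $ k - cnj (w j $ k))" using large by linarith
      have "q j k \<le> cmod (x $ k - cnj (w j $ k)) / (cmod (x $ k - cnj (w j $ k)))\<^sup>2"
        unfolding q_def using Im_le by (intro divide_right_mono) auto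
      also have "\<dots> = 1 / cmod (x $ k - cnj (w j $ k))" by (simp add: power2_eq_square)
      also have "\<dots> \<le> 1 / (real (Suc j) - cmod (x $ k))"
        using le j[of k] cmod_pos[of k j] by (intro divide_left_mono mult_pos_pos) auto
      finally show ?thesis using summands(1) unfolding s_def by linarith
    qed
    then show ?thesis by blast
  qed
  have bound: "cmod (korenblum_kernel \<gamma> (w j) x) \<le> (\<Sum>k\<in>UNIV. s j k powr (\<gamma> $ k) * Q k)"
    if j: "\<And>k. real j > cmod (x $ k)" for j
  proof -
    obtain k where k: "q j k \<le> s j k" using small[OF j] by blast
    have "cmod (korenblum_kernel \<gamma> (w j) x) = (\<Prod>k\<in>UNIV. q j k powr (\<gamma> $ k))"
      by (simp add: cmod_korenblum_kernel[OF w] q_def)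
    also have "\<dots> = q j k powr (\<gamma> $ k) * (\<Prod>l\<in>UNIV - {k}. q j l powr (\<gamma> $ l))"
      by (rule prod.remove) auto
    also have "\<dots> \<le> s j k powr (\<gamma> $ k) * Q k"
      unfolding Q_def using k q0 q_le \<gamma>
      by (intro mult_mono powr_mono2 prod_mono conjI prod_nonneg) (auto intro: less_imp_le)
    also have "\<dots> \<le> (\<Sum>k\<in>UNIV. s j k powr (\<gamma> $ k) * Q k)"
      using Q by (intro member_le_sum mult_nonneg_nonneg) auto
    finally show ?thesis .
  qed
  have large: "\<forall>\<^sub>F j in sequentially. real j > cmod (x $ k)" for k
    using filterlim_real_sequentially by (auto simp: filterlim_at_top_dense)
  then have all_large: "\<forall>\<^sub>F j in sequentially. \<forall>k. real j > cmod (x $ k)"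
    by (rule eventually_all_finite)
  show ?thesis
  proof (rule Lim_null_comparison)
    show "\<forall>\<^sub>F j in sequentially. cmod (korenblum_kernel \<gamma> (w j) x) \<le> (\<Sum>k\<in>UNIV. s j k powr (\<gamma> $ k) * Q k)"
      using all_large by eventually_elim (use bound in blast)
    show "(\<lambda>j. \<Sum>k\<in>UNIV. s j k powr (\<gamma> $ k) * Q k) \<longlonglongrightarrow> 0"
    proof (rule tendsto_null_sum)
      fix k
      have Suc_top: "filterlim (\<lambda>j. real (Suc j)) at_top sequentially"
        using filterlim_real_sequentially by (subst filterlim_sequentially_Suc)
      then have "filterlim (\<lambda>j. - cmod (x $ k) + real (Suc j)) at_top sequentially"
        by (rule filterlim_tendsto_add_at_top[OF tendsto_const])
      then have 2: "(\<lambda>j. 1 / (real (Suc j) - cmod (x $ k))) \<longlonglongrightarrow> 0"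
        by (intro tendsto_divide_0[OF tendsto_const] filterlim_at_top_imp_at_infinity) simp
      have "(\<lambda>j. 1 / real (Suc j)) \<longlonglongrightarrow> 0"
        by (intro tendsto_divide_0[OF tendsto_const] filterlim_at_top_imp_at_infinity Suc_top)
      then have 1: "(\<lambda>j. 1 / real (Suc j) / (Im (x $ k))\<^sup>2) \<longlonglongrightarrow> 0"
        using tendsto_divide[of _ 0 _ "\<lambda>_. (Im (x $ k))\<^sup>2" "(Im (x $ k))\<^sup>2"] xk[of k] by force
      have "(\<lambda>j. s j k) \<longlonglongrightarrow> 0" unfolding s_def using tendsto_add[OF 1 2] by simp
      moreover have "\<forall>\<^sub>F j in sequentially. 0 \<le> s j k"
        using large[of k] by eventually_elim (rule s_pos)
      ultimately have "(\<lambda>j. s j k powr (\<gamma> $ k)) \<longlonglongrightarrow> 0"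
        by (intro tendsto_zero_powrI[OF _ tendsto_const]) (use \<gamma> in auto)
      then show "(\<lambda>j. s j k powr (\<gamma> $ k) * Q k) \<longlonglongrightarrow> 0" by (rule tendsto_mult_left_zero)
    qed
  qed
qed

lemma korenblum_kernel_diagonal:
  assumes "w \<in> poly_upper_half"
  shows "cmod (korenblum_kernel \<gamma> w w) = (\<Prod>k\<in>UNIV. (1 / 4) powr (\<gamma> $ k)) / korenblum_weight \<gamma> w"
  unfolding cmod_korenblum_kernel[OF assms] korenblum_weight_def prod_dividef[symmetric]
proof (rule prod.cong)
  fix k
  have pos: "Im (w $ k) > 0" by (rule Im_pos[OF assms])
  have "cmod (w $ k - cnj (w $ k)) = 2 * Im (w $ k)"
    using pos by (simp add: complex_diff_cnj norm_mult)
  then have "Im (w $ k) / (cmod (w $ k - cnj (w $ k)))\<^sup>2 = (1 / 4) / Im (w $ k)"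
    using pos by (simp add: power2_eq_square field_simps)
  then show "(Im (w $ k) / (cmod (w $ k - cnj (w $ k)))\<^sup>2) powr \<gamma> $ k
      = (1 / 4) powr \<gamma> $ k / Im (w $ k) powr \<gamma> $ k"
    by (simp only: powr_divide)
qed simp

text \<open>If the boundary condition fails along points \<open>z j\<close>, the kernels at \<open>w j = \<phi> (z j)\<close>, with and without
  a Blaschke factor vanishing at \<open>w j\<close>, are bounded and tend to zero pointwise. Hence their images are
  small, whereas at \<open>z j\<close> the separation inequality bounds the failing quantity by these images. The
  hypothesis is symmetric in \<open>\<phi>\<close> and \<open>\<psi>\<close>, so the lemma also serves for the limit along \<open>\<psi>\<close>.\<close>
lemma boundary_limit_zero_if_null_sequences_preserved:
  fixes \<phi> \<psi> :: "complex ^ 'n \<Rightarrow> complex ^ 'n" and \<gamma> :: "real ^ 'n"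
  assumes \<phi>: "\<And>z. z \<in> poly_upper_half \<Longrightarrow> \<phi> z \<in> poly_upper_half"
    and \<psi>: "\<And>z. z \<in> poly_upper_half \<Longrightarrow> \<psi> z \<in> poly_upper_half"
    and \<gamma>: "\<And>k. \<gamma> $ k > 0"
    and null: "\<And>f e. \<lbrakk>\<And>j. f j \<in> korenblum_space \<gamma>;
       \<And>j z. z \<in> poly_upper_half \<Longrightarrow> korenblum_quantity \<gamma> (f j) z \<le> 1;
       \<And>z. z \<in> poly_upper_half \<Longrightarrow> (\<lambda>j. f j z) \<longlonglongrightarrow> 0; e > 0\<rbrakk> \<Longrightarrow>
       \<forall>\<^sub>F j in sequentially. \<forall>z\<in>poly_upper_half.
         cmod (f j (\<phi> z) - f j (\<psi> z)) * korenblum_weight \<gamma> z \<le> e"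
  shows "boundary_limit_zero \<phi> (\<lambda>z. poly_pseudohyp (\<phi> z) (\<psi> z) *
      (korenblum_weight \<gamma> z / korenblum_weight \<gamma> (\<phi> z)))"
proof (rule ccontr)
  let ?W = "korenblum_weight \<gamma>"
  assume "\<not> ?thesis"
  then obtain \<epsilon> where \<epsilon>: "\<epsilon> > 0"
    and no_compact: "\<not> (\<exists>\<Omega>. compact \<Omega> \<and> \<Omega> \<subseteq> poly_upper_half \<and>
      (\<forall>z\<in>poly_upper_half. \<phi> z \<in> poly_upper_half - \<Omega> \<longrightarrow>
        poly_pseudohyp (\<phi> z) (\<psi> z) * (?W z / ?W (\<phi> z)) < \<epsilon>))"
    unfolding boundary_limit_zero_def by meson
  have ex: "\<exists>z\<in>poly_upper_half. \<phi> z \<notin> \<Omega> \<and> \<epsilon> \<le> poly_pseudohyp (\<phi> z) (\<psi> z) * (?W z / ?W (\<phi> z))"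
    if "compact \<Omega>" "\<Omega> \<subseteq> poly_upper_half" for \<Omega>
    using no_compact that by (meson DiffD2 not_less)
  have "\<exists>z\<in>poly_upper_half. \<phi> z \<notin> half_plane_box (1 / real (Suc j)) (real (Suc j)) \<and>
      \<epsilon> \<le> poly_pseudohyp (\<phi> z) (\<psi> z) * (?W z / ?W (\<phi> z))" for j
    by (intro ex compact_half_plane_box half_plane_box_subset) simp
  then obtain z where z: "\<And>j. z j \<in> poly_upper_half"
    and out: "\<And>j. \<phi> (z j) \<notin> half_plane_box (1 / real (Suc j)) (real (Suc j))"
    and large: "\<And>j. \<epsilon> \<le> poly_pseudohyp (\<phi> (z j)) (\<psi> (z j)) * (?W (z j) / ?W (\<phi> (z j)))"
    by metis
  define w where "w = (\<lambda>j. \<phi> (z j))"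
  have w: "w j \<in> poly_upper_half" for j using \<phi> z by (simp add: w_def)
  define c where "c = (\<Prod>k\<in>UNIV. (1 / 4 :: real) powr (\<gamma> $ k))"
  have c: "c > 0" unfolding c_def by (intro prod_pos) simp
  \<comment> \<open>Two images of size \<open>e\<close>, divided by the constant \<open>c\<close>, add up to half of \<open>\<epsilon>\<close>.\<close>
  define e where "e = c * \<epsilon> / 4"
  have e: "e > 0" using c \<epsilon> by (simp add: e_def)
  have \<gamma>0: "\<gamma> $ k \<ge> 0" for k using \<gamma>[of k] by simp
  have to_0: "(\<lambda>j. kernel_multiple \<gamma> (w j) (g j) x) \<longlonglongrightarrow> 0"
    if x: "x \<in> poly_upper_half" and g: "\<And>j. cmod (g j x) \<le> 1" for g x
  proof (rule Lim_null_comparison)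
    show "\<forall>\<^sub>F j in sequentially. cmod (kernel_multiple \<gamma> (w j) (g j) x) \<le> cmod (korenblum_kernel \<gamma> (w j) x)"
      using g x by (auto simp: kernel_multiple_def norm_mult intro!: always_eventually mult_left_le)
    show "(\<lambda>j. cmod (korenblum_kernel \<gamma> (w j) x)) \<longlonglongrightarrow> 0"
      using korenblum_kernel_tendsto_0[of w \<gamma> x] w out \<gamma> x tendsto_norm_zero by (auto simp: w_def)
  qed
  have small: "\<forall>\<^sub>F j in sequentially. \<forall>x\<in>poly_upper_half.
      cmod (kernel_multiple \<gamma> (w j) (g j) (\<phi> x) - kernel_multiple \<gamma> (w j) (g j) (\<psi> x)) * ?W x \<le> e"
    if "\<And>j. holomorphic_several (g j) poly_upper_half"
      and le: "\<And>j x. x \<in> poly_upper_half \<Longrightarrow> cmod (g j x) \<le> 1" for g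
    by (rule null) (use that in \<open>auto intro!: kernel_multiple_in_space
      kernel_multiple_quantity_le_1 to_0 w \<gamma>0 e\<close>)
  have "\<forall>\<^sub>F j in sequentially. \<forall>k. \<forall>x\<in>poly_upper_half.
      cmod (kernel_multiple \<gamma> (w j) (blaschke_factor (w j) k) (\<phi> x) -
        kernel_multiple \<gamma> (w j) (blaschke_factor (w j) k) (\<psi> x)) * ?W x \<le> e"
    by (intro eventually_all_finite allI small holomorphic_several_blaschke_factor cmod_blaschke_factor_le_1 w)
  moreover have "\<forall>\<^sub>F j in sequentially. \<forall>x\<in>poly_upper_half.
      cmod (kernel_multiple \<gamma> (w j) (\<lambda>_. 1) (\<phi> x) - kernel_multiple \<gamma> (w j) (\<lambda>_. 1) (\<psi> x)) * ?W x \<le> e"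
    by (intro small holomorphic_several_const) simp
  ultimately have "\<forall>\<^sub>F j in sequentially. False"
  proof eventually_elim
    case (elim j)
    define u v where "u = \<phi> (z j)" and "v = \<psi> (z j)"
    have uv: "u \<in> poly_upper_half" "v \<in> poly_upper_half" using \<phi> \<psi> z by (auto simp: u_def v_def)
    have wu: "w j = u" by (simp add: w_def u_def)
    have W: "?W (z j) > 0" "?W u > 0" using korenblum_weight_pos z uv by auto
    obtain k where k: "poly_pseudohyp u v = pseudohyp (u $ k) (v $ k)"
      using poly_pseudohyp_attained by blast
    have "cmod (blaschke_factor u k u - blaschke_factor u k v) = poly_pseudohyp u v"
      using cmod_blaschke_factor[of u k v] unfolding k
      by (simp add: blaschke_factor_def pseudohyp_commute)
    then have "c / ?W u * poly_pseudohyp u v * ?W (z j) \<le> (cmod (kernel_multiple \<gamma> u (blaschke_factor u k) u -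
        kernel_multiple \<gamma> u (blaschke_factor u k) v) +
        cmod (kernel_multiple \<gamma> u (\<lambda>_. 1) u - kernel_multiple \<gamma> u (\<lambda>_. 1) v)) * ?W (z j)"
      using kernel_separates[OF uv uv(1), of \<gamma> k] korenblum_kernel_diagonal[OF uv(1), of \<gamma>] W
      by (intro mult_right_mono) (auto simp: c_def)
    also have "\<dots> \<le> e + e"
      using elim z[of j] unfolding wu distrib_right u_def v_def by (intro add_mono) auto
    finally have "c * (poly_pseudohyp u v * (?W (z j) / ?W u)) \<le> c * (\<epsilon> / 2)"
      by (simp add: e_def field_simps)
    then have "poly_pseudohyp u v * (?W (z j) / ?W u) \<le> \<epsilon> / 2"
      using c by (simp only: mult_le_cancel_left_pos)
    then show False using large[of j] \<epsilon> unfolding u_def v_def by linarith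
  qed
  then show False by simp
qed

section \<open>Compactness in the Korenblum metric\<close>

text \<open>A sequence in the closure is replaced by one in the set at distance tending to zero.\<close>
lemma (in Metric_space) compactin_closure_of_if_sequences:
  assumes S: "S \<subseteq> M"
    and conv: "\<And>\<sigma> :: nat \<Rightarrow> 'a. range \<sigma> \<subseteq> S \<Longrightarrow>
      \<exists>l r. strict_mono r \<and> limitin mtopology (\<sigma> \<circ> r) l sequentially"
  shows "compactin mtopology (mtopology closure_of S)"
  unfolding compactin_sequentially
proof (intro conjI allI impI)
  show "mtopology closure_of S \<subseteq> M" by (metis closure_of_subset_topspace topspace_mtopology)
  fix \<sigma> :: "nat \<Rightarrow> 'a" assume \<sigma>: "range \<sigma> \<subseteq> mtopology closure_of S"
  have \<sigma>M: "\<sigma> n \<in> M" for n using \<sigma> \<open>mtopology closure_of S \<subseteq> M\<close> by blast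
  have "\<exists>y\<in>S. d (\<sigma> n) y < 1 / real (Suc n)" for n
  proof -
    have "\<sigma> n \<in> mtopology closure_of S" using \<sigma> by blast
    then have "\<exists>y\<in>S. y \<in> mball (\<sigma> n) (1 / real (Suc n))" by (simp add: metric_closure_of)
    then show ?thesis by auto
  qed
  then obtain s where s: "\<And>n. s n \<in> S" "\<And>n. d (\<sigma> n) (s n) < 1 / real (Suc n)" by metis
  then obtain l r where r: "strict_mono r" and l: "limitin mtopology (s \<circ> r) l sequentially"
    using conv[of s] by blast
  have lM: "l \<in> M" and l_lim: "\<And>e. e > 0 \<Longrightarrow> \<forall>\<^sub>F n in sequentially. d (s (r n)) l < e"
    using l by (auto simp: limitin_metric elim: eventually_mono)
  have inv: "(\<lambda>n. 1 / real (Suc n)) \<longlonglongrightarrow> 0"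
    using LIMSEQ_inverse_real_of_nat by (simp add: inverse_eq_divide)
  show "\<exists>l r. l \<in> mtopology closure_of S \<and> strict_mono r \<and> limitin mtopology (\<sigma> \<circ> r) l sequentially"
  proof (intro exI[of _ l] exI[of _ r] conjI)
    show "strict_mono r" by (rule r)
    show "l \<in> mtopology closure_of S"
      unfolding metric_closure_of
    proof (clarsimp simp: lM)
      fix e :: real assume "e > 0"
      then obtain n where "d (s (r n)) l < e" using eventually_happens[OF l_lim] by auto
      then show "\<exists>y\<in>S. y \<in> M \<and> d l y < e" using s(1) S by (metis commute subsetD)
    qed
    show "limitin mtopology (\<sigma> \<circ> r) l sequentially"
      unfolding limitin_metric
    proof (intro conjI allI impI lM)
      fix e :: real assume e: "e > 0"
      then have "\<forall>\<^sub>F n in sequentially. 1 / real (Suc n) < e / 2"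
        using order_tendstoD(2)[OF inv, of "e / 2"] by simp
      then have "\<forall>\<^sub>F n in sequentially. 1 / real (Suc (r n)) < e / 2"
        using filterlim_subseq[OF r] unfolding filterlim_iff by blast
      moreover have "\<forall>\<^sub>F n in sequentially. d (s (r n)) l < e / 2" using l_lim[of "e / 2"] e by simp
      ultimately show "\<forall>\<^sub>F n in sequentially. (\<sigma> \<circ> r) n \<in> M \<and> d ((\<sigma> \<circ> r) n) l < e"
      proof eventually_elim
        case (elim n)
        have "d (\<sigma> (r n)) l \<le> d (\<sigma> (r n)) (s (r n)) + d (s (r n)) l"
          using s(1) S by (intro triangle \<sigma>M lM) auto
        then show ?case using s(2)[of "r n"] elim \<sigma>M by (simp add: o_def)
      qed
    qed
  qed
qed

lemma korenblum_quantity_le_norm: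
  assumes "f \<in> korenblum_space \<gamma>" "z \<in> poly_upper_half"
  shows "korenblum_quantity \<gamma> f z \<le> korenblum_norm \<gamma> f"
  using assms unfolding korenblum_norm_def korenblum_space_def by (auto intro: cSUP_upper)

lemma korenblum_norm_le:
  assumes "\<And>z. z \<in> poly_upper_half \<Longrightarrow> korenblum_quantity \<gamma> f z \<le> A"
  shows "korenblum_norm \<gamma> f \<le> A"
  unfolding korenblum_norm_def using poly_upper_half_nonempty assms by (rule cSUP_least)

lemma zero_in_korenblum_space: "(\<lambda>_. 0) \<in> korenblum_space \<gamma>"
  by (auto simp: korenblum_space_def korenblum_quantity_def intro: holomorphic_several_const bdd_aboveI2[where M = 0])

lemma mbounded_korenblum_iff:
  "Metric_space.mbounded (korenblum_space \<gamma>) (korenblum_dist \<gamma>) B \<longleftrightarrow>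
    B \<subseteq> korenblum_space \<gamma> \<and> (\<exists>A. \<forall>f\<in>B. \<forall>z\<in>poly_upper_half. korenblum_quantity \<gamma> f z \<le> A)"
  (is "?bdd \<longleftrightarrow> ?sub \<and> ?le")
proof -
  interpret Metric_space "korenblum_space \<gamma>" "korenblum_dist \<gamma>" by (rule Metric_space_korenblum)
  have dist_0: "korenblum_dist \<gamma> (\<lambda>_. 0) f = korenblum_norm \<gamma> f" if "f \<in> korenblum_space \<gamma>" for f
    using commute[of "\<lambda>_. 0" f] that zero_in_korenblum_space[of \<gamma>]
    by (simp add: korenblum_dist_def fun_diff_def)
  show ?thesis
  proof
    assume B: ?bdd
    then have sub: ?sub by (rule mbounded_subset_mspace)
    have "mbounded (insert (\<lambda>_. 0) B)" using B zero_in_korenblum_space by (simp add: mbounded_insert)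
    then obtain A where "\<forall>x\<in>insert (\<lambda>_. 0) B. \<forall>y\<in>insert (\<lambda>_. 0) B. korenblum_dist \<gamma> x y \<le> A"
      unfolding mbounded_alt by blast
    then have "korenblum_norm \<gamma> f \<le> A" if "f \<in> B" for f using dist_0 sub that by fastforce
    then show "?sub \<and> ?le" using sub korenblum_quantity_le_norm by (meson order_trans subsetD)
  next
    assume B: "?sub \<and> ?le"
    then obtain A where "\<And>f. f \<in> B \<Longrightarrow> korenblum_norm \<gamma> f \<le> A" using korenblum_norm_le by metis
    moreover have "\<And>f. f \<in> B \<Longrightarrow> f \<in> korenblum_space \<gamma>" using B by blast
    ultimately have "B \<subseteq> mcball (\<lambda>_. 0) A"
      by (auto simp: dist_0 zero_in_korenblum_space)
    then show ?bdd unfolding mbounded_def by blast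
  qed
qed

lemma korenblum_limitin_iff:
  assumes f: "\<And>n. f n \<in> korenblum_space \<gamma>" and l: "l \<in> korenblum_space \<gamma>"
  shows "limitin (mtopology_of (korenblum_metric \<gamma>)) f l sequentially \<longleftrightarrow>
    (\<forall>e>0. \<forall>\<^sub>F n in sequentially. \<forall>z\<in>poly_upper_half. korenblum_quantity \<gamma> (f n - l) z \<le> e)"
proof -
  interpret Metric_space "korenblum_space \<gamma>" "korenblum_dist \<gamma>" by (rule Metric_space_korenblum)
  have "limitin (mtopology_of (korenblum_metric \<gamma>)) f l sequentially \<longleftrightarrow>
      (\<forall>e>0. \<forall>\<^sub>F n in sequentially. korenblum_norm \<gamma> (f n - l) < e)"
    using f l by (simp add: mtopology_of_def limitin_metric korenblum_dist_def)
  also have "\<dots> \<longleftrightarrow>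
      (\<forall>e>0. \<forall>\<^sub>F n in sequentially. \<forall>z\<in>poly_upper_half. korenblum_quantity \<gamma> (f n - l) z \<le> e)"
    (is "?L \<longleftrightarrow> ?R")
  proof
    assume L: ?L
    show ?R
    proof (intro allI impI)
      fix e :: real assume "e > 0"
      with L have "\<forall>\<^sub>F n in sequentially. korenblum_norm \<gamma> (f n - l) < e" by blast
      then show "\<forall>\<^sub>F n in sequentially. \<forall>z\<in>poly_upper_half. korenblum_quantity \<gamma> (f n - l) z \<le> e"
        by eventually_elim
          (meson korenblum_quantity_le_norm korenblum_space_diff f l less_imp_le order_trans)
    qed
  next
    assume R: ?R
    show ?L
    proof (intro allI impI)
      fix e :: real assume e: "e > 0"
      then have "\<forall>\<^sub>F n in sequentially. \<forall>z\<in>poly_upper_half. korenblum_quantity \<gamma> (f n - l) z \<le> e / 2"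
        using R by (meson half_gt_zero)
      then show "\<forall>\<^sub>F n in sequentially. korenblum_norm \<gamma> (f n - l) < e"
      proof eventually_elim
        case (elim n)
        then have "korenblum_norm \<gamma> (f n - l) \<le> e / 2" by (intro korenblum_norm_le) blast
        then show ?case using e by linarith
      qed
    qed
  qed
  finally show ?thesis .
qed

text \<open>If the images did not tend to zero in norm, a subsequence of them would stay away from zero, and by
  compactness a further subsequence would converge in norm to some \<open>l\<close>. Then \<open>l\<close> is also the pointwise
  limit, that is, zero, a contradiction.\<close>
lemma compact_difference_preserves_null_sequences:
  fixes \<phi> \<psi> :: "complex ^ 'n \<Rightarrow> complex ^ 'n" and \<gamma> :: "real ^ 'n"
  assumes \<phi>: "\<And>z. z \<in> poly_upper_half \<Longrightarrow> \<phi> z \<in> poly_upper_half"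
    and \<psi>: "\<And>z. z \<in> poly_upper_half \<Longrightarrow> \<psi> z \<in> poly_upper_half"
    and compact: "compact_operator (korenblum_metric \<gamma>) (korenblum_metric \<gamma>) (comp_op \<phi> - comp_op \<psi>)"
    and f: "\<And>j. f j \<in> korenblum_space \<gamma>"
    and le: "\<And>j z. z \<in> poly_upper_half \<Longrightarrow> korenblum_quantity \<gamma> (f j) z \<le> 1"
    and null: "\<And>z. z \<in> poly_upper_half \<Longrightarrow> (\<lambda>j. f j z) \<longlonglongrightarrow> 0" and e: "e > 0"
  shows "\<forall>\<^sub>F j in sequentially. \<forall>z\<in>poly_upper_half.
    cmod (f j (\<phi> z) - f j (\<psi> z)) * korenblum_weight \<gamma> z \<le> e"
proof (rule ccontr)
  interpret Metric_space "korenblum_space \<gamma>" "korenblum_dist \<gamma>" by (rule Metric_space_korenblum)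
  define T where "T = comp_op \<phi> - comp_op \<psi>"
  have top: "mtopology_of (korenblum_metric \<gamma>) = mtopology" by (simp add: mtopology_of_def)
  assume "\<not> ?thesis"
  then obtain r :: "nat \<Rightarrow> nat" where r: "strict_mono r"
    "\<And>j. \<not> (\<forall>z\<in>poly_upper_half. cmod (f (r j) (\<phi> z) - f (r j) (\<psi> z)) * korenblum_weight \<gamma> z \<le> e)"
    using not_eventually_sequentiallyD by blast
  have TS: "T (f j) \<in> korenblum_space \<gamma>" for j
    using compact f unfolding compact_operator_def T_def by auto
  have "mbounded (range f)" unfolding mbounded_korenblum_iff using f le by blast
  then have comp: "compactin mtopology (mtopology closure_of (T ` range f))"
    using compact unfolding compact_operator_def top T_def by simp
  have "T ` range f \<subseteq> mtopology closure_of (T ` range f)"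
    by (rule closure_of_subset) (use TS in auto)
  then have "range (\<lambda>j. T (f (r j))) \<subseteq> mtopology closure_of (T ` range f)" by blast
  then obtain l s where s: "strict_mono s"
    and lim: "limitin mtopology ((\<lambda>j. T (f (r j))) \<circ> s) l sequentially"
    using comp unfolding compactin_sequentially by blast
  have l: "l \<in> korenblum_space \<gamma>" using lim by (simp add: limitin_metric)
  have conv: "\<forall>\<^sub>F n in sequentially. \<forall>z\<in>poly_upper_half. korenblum_quantity \<gamma> (T (f (r (s n))) - l) z \<le> e'"
    if "e' > 0" for e'
    using lim korenblum_limitin_iff[of "\<lambda>n. T (f (r (s n)))" \<gamma> l] TS l that by (simp add: top o_def)
  have l0: "l z = 0" if z: "z \<in> poly_upper_half" for z
  proof -
    let ?W = "korenblum_weight \<gamma> z"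
    have W: "?W > 0" by (rule korenblum_weight_pos[OF z])
    have "(\<lambda>j. f j (\<phi> z) - f j (\<psi> z)) \<longlonglongrightarrow> 0 - 0" by (intro tendsto_diff null \<phi> \<psi> z)
    then have "(\<lambda>j. T (f j) z) \<longlonglongrightarrow> 0" using z by (simp add: T_def comp_op_def)
    then have "((\<lambda>j. T (f j) z) \<circ> (r \<circ> s)) \<longlonglongrightarrow> 0"
      by (rule LIMSEQ_subseq_LIMSEQ) (intro strict_mono_o r s)
    then have lim0: "(\<lambda>n. T (f (r (s n))) z) \<longlonglongrightarrow> 0" by (simp add: o_def)
    have "(\<lambda>n. T (f (r (s n))) z) \<longlonglongrightarrow> l z"
      unfolding tendsto_iff
    proof (intro allI impI)
      fix \<delta> :: real assume "\<delta> > 0"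
      then have "\<forall>\<^sub>F n in sequentially. \<forall>z\<in>poly_upper_half.
          korenblum_quantity \<gamma> (T (f (r (s n))) - l) z \<le> \<delta> * ?W / 2"
        using W by (intro conv) simp
      then show "\<forall>\<^sub>F n in sequentially. dist (T (f (r (s n))) z) (l z) < \<delta>"
      proof eventually_elim
        case (elim n)
        then have "cmod (T (f (r (s n))) z - l z) * ?W \<le> \<delta> / 2 * ?W"
          using z by (auto simp: korenblum_quantity_eq)
        then have "cmod (T (f (r (s n))) z - l z) \<le> \<delta> / 2" using W by (simp only: mult_le_cancel_right_pos)
        then show ?case using \<open>\<delta> > 0\<close> by (simp add: dist_norm)
      qed
    qed
    with lim0 show ?thesis using LIMSEQ_unique by blast
  qed
  obtain n where n: "\<forall>z\<in>poly_upper_half. korenblum_quantity \<gamma> (T (f (r (s n))) - l) z \<le> e"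
    using eventually_happens[OF conv[OF e]] by auto
  have "korenblum_quantity \<gamma> (T (f (r (s n))) - l) z
      = cmod (f (r (s n)) (\<phi> z) - f (r (s n)) (\<psi> z)) * korenblum_weight \<gamma> z"
    if "z \<in> poly_upper_half" for z
    using that l0[OF that] by (simp add: korenblum_quantity_eq T_def comp_op_def)
  then show False using n r(2)[of "s n"] by simp
qed

text \<open>The weight is bounded below on every box, so norm bounded families are locally bounded; the norm
  bound itself passes to pointwise limits.\<close>
lemma korenblum_montel:
  fixes f :: "nat \<Rightarrow> complex ^ 'n \<Rightarrow> complex" and \<gamma> :: "real ^ 'n"
  assumes \<gamma>: "\<And>k. \<gamma> $ k \<ge> 0" and f: "\<And>j. f j \<in> korenblum_space \<gamma>"
    and A: "\<And>j z. z \<in> poly_upper_half \<Longrightarrow> korenblum_quantity \<gamma> (f j) z \<le> A"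
  shows "\<exists>g r. strict_mono (r :: nat \<Rightarrow> nat) \<and> g \<in> korenblum_space \<gamma> \<and>
    (\<forall>z\<in>poly_upper_half. korenblum_quantity \<gamma> g z \<le> A) \<and>
    (\<forall>K. compact K \<and> K \<subseteq> poly_upper_half \<longrightarrow> uniform_limit K (\<lambda>j. f (r j)) g sequentially)"
proof -
  have hol: "holomorphic_several (f j) poly_upper_half" for j using f by (simp add: korenblum_space_def)
  have locally_bounded: "\<exists>B. \<forall>j. \<forall>z\<in>K. cmod (f j z) \<le> B" if K: "compact K" "K \<subseteq> poly_upper_half" for K
  proof -
    obtain a b where a: "a > 0" "K \<subseteq> half_plane_box a b"
      using compact_subset_half_plane_box[OF K] by blast
    define m where "m = (\<Prod>k\<in>UNIV. a powr (\<gamma> $ k))"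
    have m: "m > 0" unfolding m_def using a by (intro prod_pos) simp
    have "cmod (f j z) \<le> A / m" if z: "z \<in> K" for j z
    proof -
      have zH: "z \<in> poly_upper_half" using z K by blast
      have "m \<le> korenblum_weight \<gamma> z"
        unfolding m_def korenblum_weight_def
        using a z by (intro prod_mono conjI powr_mono2 \<gamma>) (auto simp: half_plane_box_def)
      then have "cmod (f j z) * m \<le> cmod (f j z) * korenblum_weight \<gamma> z" by (rule mult_left_mono) simp
      also have "\<dots> \<le> A" using A[OF zH] by (simp add: korenblum_quantity_eq)
      finally show ?thesis using m by (simp add: field_simps)
    qed
    then show ?thesis by blast
  qed
  obtain h r where r: "strict_mono (r :: nat \<Rightarrow> nat)" and h: "holomorphic_several h poly_upper_half"
    and lim: "\<forall>K. compact K \<and> K \<subseteq> poly_upper_half \<longrightarrow> uniform_limit K (\<lambda>n. f (r n)) h sequentially"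
    using montel_several[OF open_poly_upper_half, of f, OF hol locally_bounded] by blast
  define g where "g = (\<lambda>z. if z \<in> poly_upper_half then h z else 0)"
  have le: "korenblum_quantity \<gamma> g z \<le> A" if z: "z \<in> poly_upper_half" for z
  proof -
    have "uniform_limit {z} (\<lambda>n. f (r n)) h sequentially" using lim[THEN spec, of "{z}"] z by simp
    then have "(\<lambda>n. f (r n) z) \<longlonglongrightarrow> h z" by (rule tendsto_uniform_limitI) simp
    then have "(\<lambda>n. cmod (f (r n) z) * korenblum_weight \<gamma> z) \<longlonglongrightarrow> cmod (h z) * korenblum_weight \<gamma> z"
      by (intro tendsto_intros)
    then have "cmod (h z) * korenblum_weight \<gamma> z \<le> A"
      by (rule LIMSEQ_le_const2) (use A[OF z] in \<open>auto simp: korenblum_quantity_eq\<close>)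
    then show ?thesis using z by (simp add: g_def korenblum_quantity_eq)
  qed
  have "holomorphic_several g poly_upper_half"
    by (rule holomorphic_several_transform[OF open_poly_upper_half h]) (simp add: g_def)
  then have "g \<in> korenblum_space \<gamma>"
    using bdd_aboveI2[where f = "korenblum_quantity \<gamma> g", OF le]
    by (simp add: korenblum_space_def) (simp add: g_def)
  moreover have "uniform_limit K (\<lambda>j. f (r j)) g sequentially"
    if K: "compact K" "K \<subseteq> poly_upper_half" for K
  proof -
    have "g x = h x" if "x \<in> K" for x using that K by (auto simp: g_def)
    then show ?thesis using lim K uniform_limit_cong'[of K "\<lambda>n. f (r n)" "\<lambda>n. f (r n)" g h] by auto
  qed
  ultimately show ?thesis using r le by blast
qed

text \<open>A bounded sequence has, by Montel's theorem, a subsequence converging uniformly on boxes to a member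
  of the space; control on boxes upgrades this to norm convergence of the images.\<close>
lemma compact_difference_if_controlled_on_boxes:
  fixes \<phi> \<psi> :: "complex ^ 'n \<Rightarrow> complex ^ 'n" and \<gamma> :: "real ^ 'n"
  assumes \<gamma>: "\<And>k. \<gamma> $ k \<ge> 0"
    and maps: "\<And>f. f \<in> korenblum_space \<gamma> \<Longrightarrow> (comp_op \<phi> - comp_op \<psi>) f \<in> korenblum_space \<gamma>"
    and small: "controlled_on_boxes \<gamma> (comp_op \<phi> - comp_op \<psi>)"
  shows "compact_operator (korenblum_metric \<gamma>) (korenblum_metric \<gamma>) (comp_op \<phi> - comp_op \<psi>)"
  unfolding compact_operator_def mspace_korenblum_metric mdist_korenblum_metric
proof (intro conjI allI impI)
  interpret Metric_space "korenblum_space \<gamma>" "korenblum_dist \<gamma>" by (rule Metric_space_korenblum)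
  define T where "T = comp_op \<phi> - comp_op \<psi>"
  have top: "mtopology_of (korenblum_metric \<gamma>) = mtopology" by (simp add: mtopology_of_def)
  show "(comp_op \<phi> - comp_op \<psi>) ` korenblum_space \<gamma> \<subseteq> korenblum_space \<gamma>" using maps by blast
  have T_diff: "T f - T g = T (f - g)" for f g
    by (auto simp: T_def comp_op_def fun_eq_iff)
  fix B assume "mbounded B"
  then obtain A where B: "B \<subseteq> korenblum_space \<gamma>"
    and A: "\<And>f z. f \<in> B \<Longrightarrow> z \<in> poly_upper_half \<Longrightarrow> korenblum_quantity \<gamma> f z \<le> A"
    unfolding mbounded_korenblum_iff by blast
  show "compactin (mtopology_of (korenblum_metric \<gamma>))
      (mtopology_of (korenblum_metric \<gamma>) closure_of (comp_op \<phi> - comp_op \<psi>) ` B)"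
    unfolding top T_def[symmetric]
  proof (rule compactin_closure_of_if_sequences)
    show "T ` B \<subseteq> korenblum_space \<gamma>" using maps B by (auto simp: T_def)
    fix \<sigma> :: "nat \<Rightarrow> _" assume "range \<sigma> \<subseteq> T ` B"
    then have "\<forall>n. \<exists>f\<in>B. \<sigma> n = T f" by blast
    then obtain f where f: "\<And>n. f n \<in> B" "\<And>n. \<sigma> n = T (f n)" by metis
    have fS: "f n \<in> korenblum_space \<gamma>" for n using f B by blast
    have fA: "korenblum_quantity \<gamma> (f n) z \<le> A" if "z \<in> poly_upper_half" for n z
      using A f(1) that by blast
    obtain g r where r: "strict_mono (r :: nat \<Rightarrow> nat)" and g: "g \<in> korenblum_space \<gamma>"
      and gA: "\<forall>z\<in>poly_upper_half. korenblum_quantity \<gamma> g z \<le> A"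
      and lim: "\<forall>K. compact K \<and> K \<subseteq> poly_upper_half \<longrightarrow> uniform_limit K (\<lambda>j. f (r j)) g sequentially"
      using korenblum_montel[of \<gamma> f A, OF \<gamma> fS fA] by blast
    obtain z0 :: "complex ^ 'n" where "z0 \<in> poly_upper_half" using poly_upper_half_nonempty by blast
    then have A0: "A \<ge> 0" using gA korenblum_quantity_nonneg order_trans by blast
    have TS: "T h \<in> korenblum_space \<gamma>" if "h \<in> korenblum_space \<gamma>" for h using maps[OF that] by (simp add: T_def)
    have "limitin mtopology (\<lambda>n. T (f (r n))) (T g) sequentially"
      unfolding korenblum_limitin_iff[OF TS[OF fS] TS[OF g], unfolded top]
    proof (intro allI impI)
      fix e :: real assume e: "e > 0"
      \<comment> \<open>Differences are bounded by \<open>2 * A\<close>; adding a constant to the denominator covers \<open>A = 0\<close>.\<close>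
      define \<epsilon> where "\<epsilon> = e / (4 * A + 2)"
      have \<epsilon>: "\<epsilon> > 0" "\<epsilon> * (2 * A) \<le> e / 2" using e A0 by (auto simp: \<epsilon>_def field_simps)
      obtain a b C where a: "a > 0" and C: "C \<ge> 0"
        and est: "\<forall>h\<in>korenblum_space \<gamma>. \<forall>D\<ge>0. \<forall>\<eta>\<ge>0.
          (\<forall>x\<in>poly_upper_half. korenblum_quantity \<gamma> h x \<le> D) \<longrightarrow>
          (\<forall>x\<in>half_plane_box a b. cmod (h x) \<le> \<eta>) \<longrightarrow>
          (\<forall>z\<in>poly_upper_half. korenblum_quantity \<gamma> (T h) z \<le> \<epsilon> * D + C * \<eta>)"
        using small[unfolded controlled_on_boxes_def T_def[symmetric], rule_format, OF \<epsilon>(1)]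
        by (elim exE conjE) (rule that)
      define \<eta> where "\<eta> = e / (2 * (C + 1))"
      have \<eta>: "\<eta> > 0" "C * \<eta> \<le> e / 2" using e C by (auto simp: \<eta>_def field_simps)
      have "uniform_limit (half_plane_box a b) (\<lambda>j. f (r j)) g sequentially"
        using lim compact_half_plane_box half_plane_box_subset[OF a] by blast
      then have "\<forall>\<^sub>F n in sequentially. \<forall>x\<in>half_plane_box a b. dist (f (r n) x) (g x) < \<eta>"
        using \<eta>(1) by (rule uniform_limitD)
      then show "\<forall>\<^sub>F n in sequentially. \<forall>z\<in>poly_upper_half. korenblum_quantity \<gamma> (T (f (r n)) - T g) z \<le> e"
      proof eventually_elim
        case (elim n)
        have "korenblum_quantity \<gamma> (f (r n) - g) x \<le> 2 * A" if "x \<in> poly_upper_half" for x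
        proof -
          have "korenblum_quantity \<gamma> (f (r n) - g) x \<le>
              korenblum_quantity \<gamma> (f (r n)) x + korenblum_quantity \<gamma> g x"
            unfolding korenblum_quantity_eq distrib_right[symmetric]
            using korenblum_weight_pos[OF that, of \<gamma>]
            by (intro mult_right_mono) (auto intro: norm_triangle_ineq4)
          then show ?thesis using fA[OF that, of "r n"] bspec[OF gA that] by linarith
        qed
        moreover have "cmod ((f (r n) - g) x) \<le> \<eta>" if "x \<in> half_plane_box a b" for x
          using elim that by (force simp: dist_norm)
        ultimately have "korenblum_quantity \<gamma> (T (f (r n) - g)) z \<le> \<epsilon> * (2 * A) + C * \<eta>"
          if "z \<in> poly_upper_half" for z
          using A0 \<eta>(1) that by (intro est[rule_format] korenblum_space_diff fS g) auto
        then show ?case unfolding T_diff using \<epsilon>(2) \<eta>(2) by fastforce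
      qed
    qed
    then show "\<exists>l r. strict_mono r \<and> limitin mtopology (\<sigma> \<circ> r) l sequentially"
      using r f(2) by (auto simp: o_def)
  qed
qed

section \<open>Compact differences of composition operators\<close>

theorem theorem5p1:
  fixes \<phi> \<psi> :: "complex ^ 'n \<Rightarrow> complex ^ 'n" and \<gamma> :: "real ^ 'n"
  assumes "holomorphic_self_map \<phi>" and "holomorphic_self_map \<psi>"
    and "\<forall>k. \<gamma> $ k > 0"
    and "\<forall>f\<in>korenblum_space \<gamma>. (comp_op \<phi> - comp_op \<psi>) f \<in> korenblum_space \<gamma>"
  shows "compact_operator (korenblum_metric \<gamma>) (korenblum_metric \<gamma>) (comp_op \<phi> - comp_op \<psi>)
    \<longleftrightarrow>
      boundary_limit_zero \<phi> (\<lambda>z. poly_pseudohyp (\<phi> z) (\<psi> z) *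
        (\<Prod>k\<in>UNIV. (Im (z $ k) / Im (\<phi> z $ k)) powr (\<gamma> $ k))) \<and>
      boundary_limit_zero \<psi> (\<lambda>z. poly_pseudohyp (\<phi> z) (\<psi> z) *
        (\<Prod>k\<in>UNIV. (Im (z $ k) / Im (\<psi> z $ k)) powr (\<gamma> $ k)))"
    (is "?compact \<longleftrightarrow> boundary_limit_zero \<phi> ?F \<and> boundary_limit_zero \<psi> ?G")
proof -
  let ?W = "korenblum_weight \<gamma>"
  define F where "F = (\<lambda>z. poly_pseudohyp (\<phi> z) (\<psi> z) * (?W z / ?W (\<phi> z)))"
  define G where "G = (\<lambda>z. poly_pseudohyp (\<phi> z) (\<psi> z) * (?W z / ?W (\<psi> z)))"
  have \<phi>: "\<phi> z \<in> poly_upper_half" and \<psi>: "\<psi> z \<in> poly_upper_half" if "z \<in> poly_upper_half" for z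
    using assms(1,2) that unfolding holomorphic_self_map_def by blast+
  have \<gamma>: "\<gamma> $ k > 0" "\<gamma> $ k \<ge> 0" for k using assms(3) by (auto intro: less_imp_le)
  have maps: "(comp_op \<phi> - comp_op \<psi>) f \<in> korenblum_space \<gamma>" if "f \<in> korenblum_space \<gamma>" for f
    using assms(4) that by blast
  have F: "?F z = F z" and G: "?G z = G z" if "z \<in> poly_upper_half" for z
    using korenblum_weight_ratio[OF that \<phi>[OF that], of \<gamma>] korenblum_weight_ratio[OF that \<psi>[OF that], of \<gamma>]
    by (simp_all add: F_def G_def)
  have "boundary_limit_zero \<phi> ?F \<longleftrightarrow> boundary_limit_zero \<phi> F"
    unfolding boundary_limit_zero_def using F by simp
  moreover have "boundary_limit_zero \<psi> ?G \<longleftrightarrow> boundary_limit_zero \<psi> G"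
    unfolding boundary_limit_zero_def using G by simp
  moreover have "?compact \<longleftrightarrow> boundary_limit_zero \<phi> F \<and> boundary_limit_zero \<psi> G"
  proof
    assume compact: ?compact
    note null = compact_difference_preserves_null_sequences[OF \<phi> \<psi> compact]
    have "boundary_limit_zero \<phi> F"
      unfolding F_def
      by (rule boundary_limit_zero_if_null_sequences_preserved) (use \<phi> \<psi> \<gamma> null in auto)
    moreover have "boundary_limit_zero \<psi> (\<lambda>z. poly_pseudohyp (\<psi> z) (\<phi> z) * (?W z / ?W (\<psi> z)))"
      by (rule boundary_limit_zero_if_null_sequences_preserved)
        (use \<phi> \<psi> \<gamma> null in \<open>auto simp: norm_minus_commute\<close>)
    then have "boundary_limit_zero \<psi> G" by (simp add: G_def poly_pseudohyp_commute)
    ultimately show "boundary_limit_zero \<phi> F \<and> boundary_limit_zero \<psi> G" by blast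
  next
    assume lim: "boundary_limit_zero \<phi> F \<and> boundary_limit_zero \<psi> G"
    have bounded: "\<exists>B. \<forall>z\<in>poly_upper_half. cmod (f (\<phi> z) - f (\<psi> z)) * ?W z \<le> B"
      if "f \<in> korenblum_space \<gamma>" for f
      using korenblum_quantity_le_norm[OF maps[OF that]] korenblum_quantity_comp_op_diff by metis
    have "controlled_on_boxes \<gamma> (comp_op \<phi> - comp_op \<psi>)"
      by (rule difference_controlled_on_boxes) (use \<phi> \<psi> \<gamma>(2) bounded lim in \<open>auto simp: F_def G_def\<close>)
    then show ?compact
      using compact_difference_if_controlled_on_boxes[OF \<gamma>(2) maps] by blast
  qed
  ultimately show ?thesis by simp
qed

end
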